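(* There is an absolute constant $C>0$ such that for every $f\in C[0,\pi]$, every $n\in\{1,2,\dots\}$ and every $\theta\in[0,\pi]$, writing $x=\cos\theta$, \[ |\mathcal{D}_n(f)(\theta)-f(\theta)|\le C\left(\omega\big(f,\delta_n(\theta)\big)+\omega\Big(f\circ\arccos,\tfrac{\sqrt{1-x^2}}{n}\Big)+\omega\Big(f\circ\arccos,\tfrac{1}{n^2}\Big)\right), \] where $\mathcal{D}_n$ is the $n$-th Gr\"unwald--Durrmeyer operator and \[ \delta_n(\theta)=\frac{n}{\pi}\sum_{k=1}^n|S_{k,n}(\theta)|\int_0^\pi|t-\theta_k^{(n)}|\,|S_{k,n}(t)|\,dt . \]
   Context: For $n=1,2,\dots$ and $k=1,\dots,n$ let $\theta_k^{(n)}=\frac{2k-1}{2n}\pi$ and \[ P_k(t)=(-1)^{k+1}\frac{\cos(nt)\,\sin\theta_k^{(n)}}{n\,(\cos t-\cos\theta_k^{(n)})},\qquad t\in\mathbb{R}, \] where the (removable) singularities are filled in by continuity ($P_k$ depends on $n$ as well). Put \[ S_{k,n}(t)=\tfrac12\left(P_k\!\left(t-\tfrac{\pi}{2n}\right)+P_k\!\left(t+\tfrac{\pi}{2n}\right)\right). \] The $n$-th Gr\"unwald--Durrmeyer operator is defined, for $f\in L^p[0,\pi]$ ($1\le p\le+\infty$, Lebesgue measure) and $\theta\in[0,\pi]$, by \[ \mathcal{D}_n(f)(\theta)=\frac{n}{\pi}\sum_{k=1}^n S_{k,n}(\theta)\int_0^\pi f(t)\,S_{k,n}(t)\,dt . \]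 For a continuous function $h$ on a compact interval $I$ and $\delta\ge0$, $\omega(h,\delta)=\sup\{|h(u)-h(v)|:u,v\in I,\ |u-v|\le\delta\}$ is the modulus of continuity. The function $f\circ\arccos$ is regarded as a continuous function on $[-1,1]$. *)

theory Defs
  imports "HOL-Analysis.Analysis"
begin

definition theta_node :: "nat \<Rightarrow> nat \<Rightarrow> real" where
  "theta_node n k = (2 * real k - 1) / (2 * real n) * pi"

definition P_quot :: "nat \<Rightarrow> nat \<Rightarrow> real \<Rightarrow> real" where
  "P_quot n k t = (-1) ^ (k + 1) *
     (cos (real n * t) * sin (theta_node n k)) / (real n * (cos t - cos (theta_node n k)))"

text \<open>The removable singularities are filled in with the limit, which exists by
  \<open>P_quot_tendsto_at_singularity\<close> below.\<close>

definition P_fun :: "nat \<Rightarrow> nat \<Rightarrow> real \<Rightarrow> real" where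
  "P_fun n k t =
     (if cos t = cos (theta_node n k) then Lim (at t) (P_quot n k) else P_quot n k t)"

definition S_fun :: "nat \<Rightarrow> nat \<Rightarrow> real \<Rightarrow> real" where
  "S_fun n k t =
     1 / 2 * (P_fun n k (t - pi / (2 * real n)) + P_fun n k (t + pi / (2 * real n)))"

definition grunwald_durrmeyer :: "nat \<Rightarrow> (real \<Rightarrow> real) \<Rightarrow> real \<Rightarrow> real" where
  "grunwald_durrmeyer n f \<theta> =
     real n / pi * (\<Sum>k=1..n. S_fun n k \<theta> * (LINT t:{0..pi}|lebesgue. f t * S_fun n k t))"

definition delta_fun :: "nat \<Rightarrow> real \<Rightarrow> real" where
  "delta_fun n \<theta> =
     real n / pi * (\<Sum>k=1..n. \<bar>S_fun n k \<theta>\<bar> *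
       (LINT t:{0..pi}|lebesgue. \<bar>t - theta_node n k\<bar> * \<bar>S_fun n k t\<bar>))"

text \<open>The supremum is the intended one only if \<open>h\<close> is bounded on \<open>I\<close>, \<open>I\<close> is nonempty
  and \<open>\<delta> \<ge> 0\<close>.\<close>

definition modulus_of_continuity :: "real set \<Rightarrow> (real \<Rightarrow> real) \<Rightarrow> real \<Rightarrow> real" where
  "modulus_of_continuity I h \<delta> = Sup {\<bar>h u - h v\<bar> | u v. u \<in> I \<and> v \<in> I \<and> \<bar>u - v\<bar> \<le> \<delta>}"

lemma theta_node_bounds:
  assumes "1 \<le> k" "k \<le> n"
  shows "0 < theta_node n k" "theta_node n k < pi"
proof -
  have "0 < (2 * real k - 1) / (2 * real n)" "(2 * real k - 1) / (2 * real n) < 1"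
    using assms by (auto simp: field_simps)
  then show "0 < theta_node n k" "theta_node n k < pi"
    unfolding theta_node_def
    using mult_strict_right_mono[of "(2 * real k - 1) / (2 * real n)" 1 pi] mult_pos_pos pi_gt_zero
    by (blast, linarith)
qed

lemma P_quot_tendsto_at_singularity:
  assumes k: "1 \<le> k" "k \<le> n" and t: "cos t = cos (theta_node n k)"
  shows "(P_quot n k \<longlongrightarrow> 1) (at t)"
proof -
  let ?a = "theta_node n k"
  have n: "real n > 0" using k by simp
  have sa: "sin ?a > 0" using theta_node_bounds[OF k] by (rule sin_gt_zero)
  have na: "real n * ?a = real (k - 1) * pi + pi / 2"
    using n k by (simp add: theta_node_def field_simps of_nat_diff)
  have cna: "cos (real n * ?a) = 0" and sna: "sin (real n * ?a) = (-1) ^ (k - 1)"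
    unfolding na by (simp_all add: cos_add sin_add sin_npi cos_npi)
  obtain m where m: "m \<in> \<int>" "t = ?a + 2 * m * pi \<or> t = - ?a + 2 * m * pi"
    using t unfolding cos_eq by blast
  obtain i :: int where i: "m = of_int i" using m(1) by (auto elim: Ints_cases)
  have nt: "real n * (b + 2 * m * pi) = real n * b + 2 * pi * of_int (int n * i)" for b
    by (simp add: i algebra_simps)
  have per: "cos (b + 2 * pi * of_int j) = cos b" "sin (b + 2 * pi * of_int j) = sin b" for b j
    by (simp_all add: cos_add sin_add sin_int_2pin cos_int_2pin)
  have st: "(sin t = sin ?a \<and> sin (real n * t) = sin (real n * ?a)) \<or>
            (sin t = - sin ?a \<and> sin (real n * t) = - sin (real n * ?a))"
    and cnt: "cos (real n * t) = 0"
  proof -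
    have per': "sin (b + 2 * m * pi) = sin b" for b
      using per(2)[of b i] by (simp only: i mult_ac)
    show "(sin t = sin ?a \<and> sin (real n * t) = sin (real n * ?a)) \<or>
            (sin t = - sin ?a \<and> sin (real n * t) = - sin (real n * ?a))"
      using m(2) per' per(2)[of "real n * ?a"] per(2)[of "real n * - ?a"] nt
      by (metis sin_minus mult_minus_right)
    show "cos (real n * t) = 0"
      using m(2) per(1)[of "real n * ?a"] per(1)[of "real n * - ?a"] nt cna
      by (metis cos_minus mult_minus_right)
  qed
  have st0: "sin t \<noteq> 0" using st sa by auto
  have lin: "((\<lambda>y. (g y - g t) / (y - t)) \<longlongrightarrow> D) (at t)"
    if "(g has_real_derivative D) (at t)" for g D
    using that by (simp add: has_field_derivative_iff)
  have "((\<lambda>y. cos (real n * y)) has_real_derivative - (real n * sin (real n * t))) (at t)"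
    by (auto intro!: derivative_eq_intros)
  from lin[OF this] have A: "((\<lambda>y. cos (real n * y) / (y - t)) \<longlongrightarrow> - (real n * sin (real n * t))) (at t)"
    by (simp add: cnt)
  have "(cos has_real_derivative - sin t) (at t)"
    by (auto intro!: derivative_eq_intros)
  from lin[OF this] have B: "((\<lambda>y. (cos y - cos ?a) / (y - t)) \<longlongrightarrow> - sin t) (at t)"
    by (simp add: t)
  have "((\<lambda>y. (-1) ^ (k + 1) * (sin ?a / real n) *
      ((cos (real n * y) / (y - t)) / ((cos y - cos ?a) / (y - t)))) \<longlongrightarrow>
      (-1) ^ (k + 1) * (sin ?a / real n) * (- (real n * sin (real n * t)) / (- sin t))) (at t)"
    by (intro tendsto_intros A B) (use st0 in auto)
  moreover have "(-1) ^ (k + 1) * (sin ?a / real n) * (- (real n * sin (real n * t)) / (- sin t)) = 1"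
  proof -
    have "sin (real n * t) / sin t = (-1) ^ (k - 1) / sin ?a"
      using st sna by auto
    moreover have "(-1) ^ (k + 1) * (sin ?a / real n) * (- (real n * sin (real n * t)) / (- sin t))
       = (-1) ^ (k + 1) * sin ?a * (sin (real n * t) / sin t)"
      using n by simp
    ultimately have "(-1) ^ (k + 1) * (sin ?a / real n) * (- (real n * sin (real n * t)) / (- sin t))
       = (-1) ^ (k + 1) * (-1) ^ (k - 1) * (sin ?a / sin ?a)"
      by simp
    also have "\<dots> = (-1) ^ (2 * k)"
      using sa k by (simp flip: power_add)
    finally show ?thesis by simp
  qed
  moreover have "\<forall>\<^sub>F y in at t. (-1) ^ (k + 1) * (sin ?a / real n) *
      ((cos (real n * y) / (y - t)) / ((cos y - cos ?a) / (y - t))) = P_quot n k y"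
    by (auto simp: eventually_at_filter P_quot_def mult_ac)
  ultimately show ?thesis
    using tendsto_cong by fastforce
qed

end

theory Submission
  imports Defs
begin

text \<open>
  Expanding in cosines shows that the \<open>S_fun n k\<close> sum to 1 over \<open>k\<close> and have integral
  \<open>\<pi> / n\<close> each, so the error of the Durrmeyer operator splits into the integrals of
  \<open>(f t - f \<theta>\<^sub>k) S_fun n k t\<close> and the error of the interpolation process with values
  \<open>f \<theta>\<^sub>k\<close>. The averaging over two shifts makes \<open>S_fun n k t\<close> decay like
  \<open>1 / (n (t - \<theta>\<^sub>k))\<^sup>2\<close>, which bounds the first part by the modulus of \<open>f\<close> at
  \<open>\<delta>\<^sub>n\<close>. For the second part this decay alone loses a logarithm. Away from the node closest
  to \<open>t\<close>, however, the \<open>S_fun n k t\<close> alternate in sign and decrease in absolute value, so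
  Abel summation replaces the differences of \<open>f \<circ> arccos\<close> between \<open>cos \<theta>\<^sub>k\<close> and
  \<open>cos t\<close> by differences at adjacent nodes.
\<close>

subsection \<open>The modulus of continuity\<close>

lemma abs_diff_le_modulus:
  assumes f: "continuous_on {a..b} f" and "u \<in> {a..b}" "v \<in> {a..b}" "\<bar>u - v\<bar> \<le> \<delta>"
  shows "\<bar>f u - f v\<bar> \<le> modulus_of_continuity {a..b} f \<delta>"
proof -
  have "bounded (f ` {a..b})"
    using f by (intro compact_imp_bounded compact_continuous_image) auto
  then obtain B where "\<bar>f x\<bar> \<le> B" if "x \<in> {a..b}" for x
    unfolding bounded_real by blast
  then have "\<bar>f u - f v\<bar> \<le> 2 * B" if "u \<in> {a..b}" "v \<in> {a..b}" for u v
    using that by (smt (verit))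
  then have "bdd_above {\<bar>f u - f v\<bar> | u v. u \<in> {a..b} \<and> v \<in> {a..b} \<and> \<bar>u - v\<bar> \<le> \<delta>}"
    by (intro bdd_aboveI[of _ "2 * B"]) auto
  then show ?thesis
    unfolding modulus_of_continuity_def using assms by (intro cSup_upper) auto
qed

lemma modulus_nonneg:
  assumes "continuous_on {a..b} f" "a \<le> b" "0 \<le> \<delta>"
  shows "0 \<le> modulus_of_continuity {a..b} f \<delta>"
  using abs_diff_le_modulus[OF assms(1), of a a \<delta>] assms by auto

lemma modulus_add_le:
  assumes f: "continuous_on {a..b} f" and "a \<le> b" "0 \<le> \<delta>" "0 \<le> \<epsilon>"
  shows "modulus_of_continuity {a..b} f (\<delta> + \<epsilon>) \<le>
    modulus_of_continuity {a..b} f \<delta> + modulus_of_continuity {a..b} f \<epsilon>"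
proof -
  have le: "\<bar>f u - f v\<bar> \<le> modulus_of_continuity {a..b} f \<delta> + modulus_of_continuity {a..b} f \<epsilon>"
    if uv: "u \<in> {a..b}" "v \<in> {a..b}" "u \<le> v" "v - u \<le> \<delta> + \<epsilon>" for u v
  proof -
    define w where "w = min v (u + \<delta>)"
    have w: "w \<in> {a..b}" "\<bar>u - w\<bar> \<le> \<delta>" "\<bar>w - v\<bar> \<le> \<epsilon>"
      using uv assms by (auto simp: w_def min_def)
    from abs_diff_le_modulus[OF f uv(1) w(1,2)] abs_diff_le_modulus[OF f w(1) uv(2) w(3)]
    show ?thesis by linarith
  qed
  show ?thesis
    unfolding modulus_of_continuity_def[of _ _ "\<delta> + \<epsilon>"]
  proof (rule cSup_least)
    show "{\<bar>f u - f v\<bar> |u v. u \<in> {a..b} \<and> v \<in> {a..b} \<and> \<bar>u - v\<bar> \<le> \<delta> + \<epsilon>} \<noteq> {}"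
      using assms by fastforce
  next
    fix x assume "x \<in> {\<bar>f u - f v\<bar> |u v. u \<in> {a..b} \<and> v \<in> {a..b} \<and> \<bar>u - v\<bar> \<le> \<delta> + \<epsilon>}"
    then obtain u v where x: "x = \<bar>f u - f v\<bar>" and uv: "u \<in> {a..b}" "v \<in> {a..b}" "\<bar>u - v\<bar> \<le> \<delta> + \<epsilon>"
      by blast
    show "x \<le> modulus_of_continuity {a..b} f \<delta> + modulus_of_continuity {a..b} f \<epsilon>"
      using le[of u v] le[of v u] uv unfolding x by (cases "u \<le> v") (auto simp: abs_minus_commute)
  qed
qed

text \<open>Subadditivity of the modulus is applied to a step count N with |u - v| \<le> N \<delta>
  and N \<le> 1 + |u - v| / \<delta>. A bound linear in |u - v| can be summed and integrated against
  the kernels.\<close>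

lemma abs_diff_le_modulus_scaled:
  assumes f: "continuous_on {a..b} f" and uv: "u \<in> {a..b}" "v \<in> {a..b}" and d: "0 < \<delta>"
  shows "\<bar>f u - f v\<bar> \<le> (1 + \<bar>u - v\<bar> / \<delta>) * modulus_of_continuity {a..b} f \<delta>"
proof -
  let ?w = "modulus_of_continuity {a..b} f"
  have ab: "a \<le> b" using uv by auto
  have mult: "?w (real N * \<delta>) \<le> real N * ?w \<delta>" if "N \<ge> 1" for N
    using that
  proof (induction N rule: dec_induct)
    case (step N)
    have "?w (real (Suc N) * \<delta>) \<le> ?w (real N * \<delta>) + ?w \<delta>"
      using modulus_add_le[OF f ab, of "real N * \<delta>" \<delta>] d by (simp add: algebra_simps)
    with step.IH show ?case by (simp add: algebra_simps)
  qed simp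
  define N where "N = nat \<lfloor>\<bar>u - v\<bar> / \<delta>\<rfloor> + 1"
  have q: "0 \<le> \<bar>u - v\<bar> / \<delta>" using d by simp
  have N: "real N \<le> 1 + \<bar>u - v\<bar> / \<delta>" "\<bar>u - v\<bar> / \<delta> \<le> real N" "N \<ge> 1"
    using q unfolding N_def by linarith+
  have "\<bar>f u - f v\<bar> \<le> ?w (real N * \<delta>)"
    using N(2) d by (intro abs_diff_le_modulus[OF f uv]) (simp add: field_simps)
  also have "\<dots> \<le> real N * ?w \<delta>" by (rule mult[OF N(3)])
  also have "\<dots> \<le> (1 + \<bar>u - v\<bar> / \<delta>) * ?w \<delta>"
    using modulus_nonneg[OF f ab, of \<delta>] d N(1) by (intro mult_right_mono) auto
  finally show ?thesis .
qed

subsection \<open>Alternating sums\<close>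

text \<open>Summation by parts: the partial sums \<open>W i\<close> of an alternating series with
  increasing absolute values are bounded by the last term \<open>a i\<close>. So \<open>e\<close>
  enters only through adjacent differences and one boundary value at the large end.\<close>

lemma abs_alternating_sum_le:
  fixes a e b :: "nat \<Rightarrow> real"
  assumes a0: "0 \<le> a 0" and mono: "\<And>i. i < N \<Longrightarrow> a i \<le> a (Suc i)"
    and inner: "\<And>i. i < N \<Longrightarrow> a i * \<bar>e i - e (Suc i)\<bar> \<le> b i"
    and last: "a N * \<bar>e N\<bar> \<le> b N"
  shows "\<bar>\<Sum>i\<le>N. (-1) ^ i * a i * e i\<bar> \<le> (\<Sum>i\<le>N. b i)"
proof -
  define W where "W i = (\<Sum>j\<le>i. (-1) ^ j * a j)" for i
  \<comment> \<open>Including the sign in the invariant makes the induction close, because the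
    signed partial sums satisfy w(i+1) = a(i+1) - w(i).\<close>
  have W: "0 \<le> (-1) ^ i * W i \<and> (-1) ^ i * W i \<le> a i" if "i \<le> N" for i
    using that
  proof (induction i)
    case (Suc i)
    have "(-1) ^ Suc i * W (Suc i) = a (Suc i) - (-1) ^ i * W i"
      by (simp add: W_def algebra_simps flip: mult.assoc power_add)
    with Suc mono[of i] show ?case by auto
  qed (use a0 in \<open>simp add: W_def\<close>)
  have absW: "\<bar>W i\<bar> \<le> a i" if "i \<le> N" for i
  proof -
    have "\<bar>W i\<bar> = \<bar>(-1) ^ i * W i\<bar>" by (simp add: abs_mult power_abs)
    with W[OF that] show ?thesis by linarith
  qed
  have parts: "(\<Sum>i\<le>M. (-1) ^ i * a i * e i) = W M * e M + (\<Sum>i<M. W i * (e i - e (Suc i)))" for M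
    by (induction M) (auto simp: W_def algebra_simps)
  have "\<bar>\<Sum>i\<le>N. (-1) ^ i * a i * e i\<bar> \<le> \<bar>W N * e N\<bar> + (\<Sum>i<N. \<bar>W i * (e i - e (Suc i))\<bar>)"
    unfolding parts by (intro order_trans[OF abs_triangle_ineq] add_left_mono sum_abs)
  also have "\<dots> \<le> b N + (\<Sum>i<N. b i)"
  proof (intro add_mono sum_mono)
    show "\<bar>W N * e N\<bar> \<le> b N"
      using mult_right_mono[OF absW[of N], of "\<bar>e N\<bar>"] last by (simp add: abs_mult)
  next
    fix i assume "i \<in> {..<N}"
    then show "\<bar>W i * (e i - e (Suc i))\<bar> \<le> b i"
      using mult_right_mono[OF absW[of i], of "\<bar>e i - e (Suc i)\<bar>"] inner[of i] by (simp add: abs_mult)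
  qed
  finally show ?thesis by (simp add: lessThan_Suc_atMost[symmetric])
qed

text \<open>The common sign is a factor \<open>s\<close> with |s| \<le> 1 rather than 1 or -1, so
  that \<open>sgn\<close> of a possibly vanishing factor can be inserted.\<close>

lemma abs_alternating_sum_increasing_le:
  fixes S e b :: "nat \<Rightarrow> real"
  assumes "p \<le> q" and s: "\<bar>s\<bar> \<le> 1"
    and alt: "\<And>k. p \<le> k \<Longrightarrow> k \<le> q \<Longrightarrow> S k = (-1) ^ k * s * \<bar>S k\<bar>"
    and mono: "\<And>k. p \<le> k \<Longrightarrow> k < q \<Longrightarrow> \<bar>S k\<bar> \<le> \<bar>S (Suc k)\<bar>"
    and inner: "\<And>k. p \<le> k \<Longrightarrow> k < q \<Longrightarrow> \<bar>S k\<bar> * \<bar>e k - e (Suc k)\<bar> \<le> b k"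
    and last: "\<bar>S q\<bar> * \<bar>e q\<bar> \<le> b q"
  shows "\<bar>\<Sum>k=p..q. S k * e k\<bar> \<le> (\<Sum>k=p..q. b k)"
proof -
  obtain N where q: "q = p + N" using \<open>p \<le> q\<close> le_Suc_ex by blast
  have shift: "sum f {p..q} = (\<Sum>i\<le>N. f (p + i))" for f :: "nat \<Rightarrow> real"
    unfolding q using sum.shift_bounds_cl_nat_ivl[of f 0 p N] by (simp add: add.commute atLeast0AtMost)
  have "(\<Sum>k=p..q. S k * e k) = (\<Sum>i\<le>N. ((-1) ^ p * s) * ((-1) ^ i * \<bar>S (p + i)\<bar> * e (p + i)))"
    unfolding shift by (intro sum.cong refl, subst alt) (auto simp: q power_add)
  also have "\<dots> = ((-1) ^ p * s) * (\<Sum>i\<le>N. (-1) ^ i * \<bar>S (p + i)\<bar> * e (p + i))"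
    by (rule sum_distrib_left[symmetric])
  finally have "\<bar>\<Sum>k=p..q. S k * e k\<bar> = \<bar>s\<bar> * \<bar>\<Sum>i\<le>N. (-1) ^ i * \<bar>S (p + i)\<bar> * e (p + i)\<bar>"
    by (simp add: abs_mult power_abs)
  also have "\<dots> \<le> 1 * \<bar>\<Sum>i\<le>N. (-1) ^ i * \<bar>S (p + i)\<bar> * e (p + i)\<bar>"
    using s by (intro mult_right_mono) auto
  also have "\<dots> \<le> (\<Sum>i\<le>N. b (p + i))"
    unfolding mult_1
  proof (rule abs_alternating_sum_le)
    show "\<bar>S (p + N)\<bar> * \<bar>e (p + N)\<bar> \<le> b (p + N)" using last q by simp
  qed (use mono inner in \<open>auto simp: q\<close>)
  finally show ?thesis by (simp add: shift)
qed

text \<open>Reversing the index by k \<mapsto> p + q - k reduces this to the increasing case. The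
  reversal changes all signs by (-1)^(p+q), which is absorbed into \<open>s\<close>, and the
  boundary value now sits at \<open>p\<close>.\<close>

lemma abs_alternating_sum_decreasing_le:
  fixes S e b :: "nat \<Rightarrow> real"
  assumes "p \<le> q" and s: "\<bar>s\<bar> \<le> 1"
    and alt: "\<And>k. p \<le> k \<Longrightarrow> k \<le> q \<Longrightarrow> S k = (-1) ^ k * s * \<bar>S k\<bar>"
    and mono: "\<And>k. p \<le> k \<Longrightarrow> k < q \<Longrightarrow> \<bar>S (Suc k)\<bar> \<le> \<bar>S k\<bar>"
    and inner: "\<And>k. p \<le> k \<Longrightarrow> k < q \<Longrightarrow> \<bar>S (Suc k)\<bar> * \<bar>e (Suc k) - e k\<bar> \<le> b (Suc k)"
    and first: "\<bar>S p\<bar> * \<bar>e p\<bar> \<le> b p"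
  shows "\<bar>\<Sum>k=p..q. S k * e k\<bar> \<le> (\<Sum>k=p..q. b k)"
proof -
  define r where "r k = p + q - k" for k
  have rev: "sum f {p..q} = (\<Sum>k=p..q. f (r k))" for f :: "nat \<Rightarrow> real"
    unfolding r_def using sum.atLeastAtMost_rev[of f p q] by (simp add: add.commute)
  have rS: "p \<le> r (Suc k)" "r (Suc k) < q" "r k = Suc (r (Suc k))" if "p \<le> k" "k < q" for k
    using that by (auto simp: r_def)
  have sg: "(-1 :: real) ^ r k = (-1) ^ k * (-1) ^ (p + q)" if "k \<le> q" for k
  proof -
    have "p + q = r k + k" using that by (simp add: r_def)
    moreover have "(-1 :: real) ^ k * (-1) ^ k = 1" by (simp flip: power_mult_distrib)
    ultimately show ?thesis by (simp add: power_add)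
  qed
  show ?thesis
    unfolding rev[of "\<lambda>k. S k * e k"] rev[of b]
  proof (rule abs_alternating_sum_increasing_le[where s = "(-1) ^ (p + q) * s"])
    fix k assume k: "p \<le> k" "k \<le> q"
    then have "S (r k) = (-1) ^ r k * s * \<bar>S (r k)\<bar>" by (intro alt) (auto simp: r_def)
    then show "S (r k) = (-1) ^ k * ((-1) ^ (p + q) * s) * \<bar>S (r k)\<bar>"
      using k by (simp add: sg mult.assoc)
  next
    fix k assume k: "p \<le> k" "k < q"
    show "\<bar>S (r k)\<bar> \<le> \<bar>S (r (Suc k))\<bar>"
      using mono[OF rS(1,2)[OF k]] by (simp only: rS(3)[OF k])
    show "\<bar>S (r k)\<bar> * \<bar>e (r k) - e (r (Suc k))\<bar> \<le> b (r k)"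
      using inner[OF rS(1,2)[OF k]] by (simp only: rS(3)[OF k])
  qed (use assms in \<open>auto simp: r_def abs_mult power_abs\<close>)
qed

lemma sum_inverse_square_shifted_le:
  "(\<Sum>k=1..n. 1 / (1 + (real k - real m)\<^sup>2)) \<le> 8"
proof -
  \<comment> \<open>\<open>G\<close> is odd, increasing and bounded by 1, and its increments over
    unit steps are comparable to the summands. The sum is thus dominated by a telescoping one, with
    total at most 4 * (1 - (-1)) = 8.\<close>
  define G where "G x = x / (1 + \<bar>x\<bar>)" for x :: real
  have G: "\<bar>G x\<bar> \<le> 1" for x by (simp add: G_def field_simps)
  have pos: "1 / (1 + (real j)\<^sup>2) \<le> 4 * (G (real j + 1) - G (real j))" for j
  proof -
    have "G (real j + 1) - G (real j) = 1 / ((1 + real j) * (2 + real j))"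
      unfolding G_def by (simp add: field_simps)
    \<comment> \<open>The difference of the two sides is 3 (j - 1/2)^2 + 5/4.\<close>
    moreover have "(1 + real j) * (2 + real j) \<le> 4 * (1 + (real j)\<^sup>2)"
      using zero_le_power2[of "real j - 1/2"] by (simp add: power2_eq_square algebra_simps)
    ultimately show ?thesis
      by (simp add: field_simps add_pos_nonneg)
  qed
  have step: "1 / (1 + (real k - real m)\<^sup>2) \<le> 4 * (G (real k + 1 - real m) - G (real k - real m))" for k
  proof (cases "k \<ge> m")
    case True
    then show ?thesis using pos[of "k - m"] by (simp add: of_nat_diff algebra_simps)
  next
    case False
    then obtain i where i: "m = Suc (k + i)" using less_iff_Suc_add by (auto simp: not_le)
    have "G (real k + 1 - real m) - G (real k - real m) = G (real i + 1) - G (real i)"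
      by (simp add: i G_def field_simps)
    moreover have "1 / (1 + (real k - real m)\<^sup>2) \<le> 1 / (1 + (real i)\<^sup>2)"
      by (intro divide_left_mono) (auto simp: i power2_eq_square algebra_simps add_pos_nonneg)
    ultimately show ?thesis using pos[of i] by simp
  qed
  have "(\<Sum>k=1..n. 1 / (1 + (real k - real m)\<^sup>2)) \<le> (\<Sum>k=1..n. 4 * (G (real (Suc k) - real m) - G (real k - real m)))"
    using step by (intro sum_mono) (simp add: add.commute)
  also have "\<dots> = 4 * (G (real (Suc n) - real m) - G (real 1 - real m))"
    by (simp only: flip: sum_distrib_left) (subst sum_Suc_diff, auto)
  also have "\<dots> \<le> 4 * (1 - (-1))"
    using G[of "real (Suc n) - real m"] G[of "real 1 - real m"]
    unfolding abs_le_iff by (intro mult_left_mono diff_mono) auto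
  finally show ?thesis by simp
qed

subsection \<open>Cosine expansions and decay of the kernels\<close>

text \<open>The Christoffel-Darboux formula for Chebyshev polynomials, by induction from the
  three-term recurrence \<open>rec\<close>. If \<open>a\<close> is a zero of the polynomial of
  degree \<open>Suc n\<close>, only the first product on the right survives.\<close>

lemma christoffel_darboux_cos:
  "(1 + 2 * (\<Sum>j=1..n. cos (real j * a) * cos (real j * t))) * (cos t - cos a) =
     cos (real (Suc n) * t) * cos (real n * a) - cos (real n * t) * cos (real (Suc n) * a)"
proof (induction n)
  case 0
  then show ?case by simp
next
  case (Suc n)
  have rec: "cos (real (Suc (Suc n)) * u) = 2 * cos (real (Suc n) * u) * cos u - cos (real n * u)" for u
  proof -
    have "cos (real (Suc n) * u + u) + cos (real (Suc n) * u - u) = 2 * cos (real (Suc n) * u) * cos u"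
      by (simp add: cos_add cos_diff)
    then show ?thesis by (simp add: algebra_simps)
  qed
  let ?s = "\<Sum>j=1..n. cos (real j * a) * cos (real j * t)"
  let ?p = "cos (real (Suc n) * a) * cos (real (Suc n) * t)"
  have "(1 + 2 * (?s + ?p)) * (cos t - cos a) = (1 + 2 * ?s) * (cos t - cos a) + 2 * ?p * (cos t - cos a)"
    by (simp only: distrib_right distrib_left)
  then show ?case
    unfolding rec Suc.IH by (simp add: algebra_simps)
qed

lemma cos_n_theta_node:
  assumes "1 \<le> k" "k \<le> n"
  shows "cos (real n * theta_node n k) = 0"
    and "cos (real (n - 1) * theta_node n k) = (-1) ^ (k + 1) * sin (theta_node n k)"
proof -
  let ?a = "theta_node n k"
  have na: "real n * ?a = real (k - 1) * pi + pi / 2"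
    using assms by (simp add: theta_node_def field_simps of_nat_diff)
  show c: "cos (real n * ?a) = 0"
    unfolding na by (simp add: cos_add sin_npi)
  have "sin (real n * ?a) = (-1) ^ (k - 1)"
    unfolding na by (simp add: sin_add cos_npi)
  also have "\<dots> = (-1) ^ (k + 1)"
    using assms by (cases k) auto
  finally have s: "sin (real n * ?a) = (-1) ^ (k + 1)" .
  have "real (n - 1) * ?a = real n * ?a - ?a"
    using assms by (simp add: of_nat_diff algebra_simps)
  then show "cos (real (n - 1) * ?a) = (-1) ^ (k + 1) * sin ?a"
    by (simp add: cos_diff c s)
qed

text \<open>\<open>P_fun n k\<close> is the Lagrange basis function of the k-th Chebyshev node. Away
  from the singularities the expansion is \<open>christoffel_darboux_cos\<close> with
  \<open>n - 1\<close> for \<open>n\<close>, and at a singularity it follows by taking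
  limits.\<close>

lemma P_fun_cos_sum:
  assumes k: "1 \<le> k" "k \<le> n"
  shows "P_fun n k t = (1 + 2 * (\<Sum>j=1..n-1. cos (real j * theta_node n k) * cos (real j * t))) / real n"
    (is "_ = ?Q t")
proof -
  let ?a = "theta_node n k"
  have n: "real n > 0" using k by simp
  have quot: "P_quot n k y = ?Q y" if "cos y \<noteq> cos ?a" for y
  proof -
    have "(1 + 2 * (\<Sum>j=1..n-1. cos (real j * ?a) * cos (real j * y))) * (cos y - cos ?a)
        = cos (real n * y) * ((-1) ^ (k + 1) * sin ?a)"
      using christoffel_darboux_cos[of ?a y "n - 1"] k
      unfolding Suc_diff_1[OF less_le_trans[OF zero_less_one k(1), THEN less_le_trans, OF k(2)]]
        cos_n_theta_node[OF k] by simp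
    then show ?thesis
      using that n by (simp add: P_quot_def divide_simps mult_ac)
  qed
  show ?thesis
  proof (cases "cos t = cos ?a")
    case True
    note lim = P_quot_tendsto_at_singularity[OF k True]
    \<comment> \<open>Division by zero makes \<^const>\<open>P_quot\<close> vanish at its singularities, so they are isolated.\<close>
    have "\<forall>\<^sub>F y in at t. P_quot n k y \<noteq> 0"
      using lim by (rule tendsto_imp_eventually_ne) simp
    then have "\<forall>\<^sub>F y in at t. P_quot n k y = ?Q y"
      by (rule eventually_mono) (rule quot, auto simp: P_quot_def)
    moreover have "(?Q \<longlongrightarrow> ?Q t) (at t)"
      by (intro tendsto_intros) (use n in auto)
    ultimately have "(P_quot n k \<longlongrightarrow> ?Q t) (at t)"
      using tendsto_cong by fastforce
    then show ?thesis
      using True by (simp add: P_fun_def tendsto_Lim)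
  qed (simp add: P_fun_def quot)
qed

text \<open>Averaging over the two shifts multiplies the j-th coefficient by cos (j \<pi> / (2 n)).
  Continuity, the integral and the sum over \<open>k\<close> are all read off from this
  form.\<close>

lemma S_fun_cos_sum:
  assumes k: "1 \<le> k" "k \<le> n"
  shows "S_fun n k t = (1 + 2 * (\<Sum>j=1..n-1. cos (real j * theta_node n k) *
      cos (real j * (pi / (2 * real n))) * cos (real j * t))) / real n"
proof -
  have "cos (real j * (t - u)) + cos (real j * (t + u)) = 2 * cos (real j * u) * cos (real j * t)" for j u
    by (simp add: cos_add cos_diff algebra_simps)
  then have "(\<Sum>j=1..n-1. cos (real j * theta_node n k) * cos (real j * (t - u))) +
        (\<Sum>j=1..n-1. cos (real j * theta_node n k) * cos (real j * (t + u))) =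
        2 * (\<Sum>j=1..n-1. cos (real j * theta_node n k) * cos (real j * u) * cos (real j * t))" for u
    by (simp flip: sum.distrib distrib_left add: sum_distrib_left mult_ac)
  from this[of "pi / (2 * real n)"] show ?thesis
    using k unfolding S_fun_def P_fun_cos_sum[OF k]
    by (simp add: add_divide_distrib[symmetric] distrib_left[symmetric] divide_eq_eq eq_divide_eq)
qed

lemma continuous_on_S_fun [continuous_intros]:
  assumes "1 \<le> k" "k \<le> n"
  shows "continuous_on A (S_fun n k)"
proof -
  have "continuous_on A (\<lambda>t. (1 + 2 * (\<Sum>j=1..n-1. cos (real j * theta_node n k) *
      cos (real j * (pi / (2 * real n))) * cos (real j * t))) / real n)"
    using assms by (intro continuous_intros) auto
  then show ?thesis
    unfolding S_fun_cos_sum[OF assms, abs_def] .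
qed

text \<open>A crude bound from at most n - 1 cosine terms. It serves for nodes close to
  \<open>t\<close>, where the denominators of the quotient form may vanish.\<close>

lemma abs_S_fun_le_2:
  assumes k: "1 \<le> k" "k \<le> n"
  shows "\<bar>S_fun n k t\<bar> \<le> 2"
proof -
  let ?T = "\<lambda>j. cos (real j * theta_node n k) * cos (real j * (pi / (2 * real n))) * cos (real j * t)"
  have "\<bar>?T j\<bar> \<le> 1" for j
    unfolding abs_mult by (intro mult_le_one) auto
  then have "(\<Sum>j=1..n-1. \<bar>?T j\<bar>) \<le> (\<Sum>j=1..n-1. 1)"
    by (intro sum_mono)
  then have "\<bar>\<Sum>j=1..n-1. ?T j\<bar> \<le> real n - 1"
    using k by (intro order_trans[OF sum_abs]) (simp add: of_nat_diff)
  then show ?thesis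
    using k unfolding S_fun_cos_sum[OF k] by (auto simp: field_simps abs_le_iff)
qed

lemma S_fun_has_integral:
  assumes k: "1 \<le> k" "k \<le> n"
  shows "(S_fun n k has_integral pi / real n) {0..pi}"
proof -
  have c: "((\<lambda>t. cos (real j * t)) has_integral 0) {0..pi}" if "j \<in> {1..n-1}" for j
  proof -
    have "((\<lambda>t. cos (real j * t)) has_integral (sin (real j * pi) / real j - sin (real j * 0) / real j)) {0..pi}"
      using that
      by (intro fundamental_theorem_of_calculus)
        (auto intro!: derivative_eq_intros simp flip: has_real_derivative_iff_has_vector_derivative)
    then show ?thesis by simp
  qed
  have "((\<lambda>t. (1 + 2 * (\<Sum>j=1..n-1. cos (real j * theta_node n k) *
      cos (real j * (pi / (2 * real n))) * cos (real j * t))) / real n) has_integral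
      ((pi - 0) *\<^sub>R 1 + 2 * (\<Sum>j=1..n-1. cos (real j * theta_node n k) *
      cos (real j * (pi / (2 * real n))) * 0)) / real n) {0..pi}"
    by (intro has_integral_divide has_integral_add has_integral_mult_right has_integral_sum c
         has_integral_const_real[of 1 0 pi, simplified, THEN has_integral_eq_rhs]) auto
  then show ?thesis
    unfolding S_fun_cos_sum[OF k, abs_def] by simp
qed

lemma sum_cos_theta_node:
  assumes "1 \<le> j" "j < n"
  shows "(\<Sum>k=1..n. cos (real j * theta_node n k)) = 0"
proof -
  \<comment> \<open>The angles j \<theta>_k are the odd multiples of \<open>b\<close>, so
    multiplication by 2 sin b makes the sum telescope. The end values sin (j \<pi>) and sin 0
    vanish.\<close>
  define b where "b = real j * pi / (2 * real n)"
  have n: "real n > 0" using assms by simp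
  have b: "0 < b" "b < pi"
    using assms by (auto simp: b_def field_simps)
  have tele: "2 * sin b * cos (real j * theta_node n (Suc i)) = sin (2 * real (Suc i) * b) - sin (2 * real i * b)" for i
  proof -
    have "real j * theta_node n (Suc i) = 2 * real i * b + b"
      using n by (simp add: theta_node_def b_def field_simps)
    moreover have "sin ((2 * real i * b + b) + b) - sin ((2 * real i * b + b) - b) = 2 * sin b * cos (2 * real i * b + b)"
      by (simp only: sin_add sin_diff) (simp add: algebra_simps)
    ultimately show ?thesis by (simp add: algebra_simps)
  qed
  have "2 * sin b * (\<Sum>k=1..n. cos (real j * theta_node n k)) = (\<Sum>i<n. 2 * sin b * cos (real j * theta_node n (Suc i)))"
    by (simp only: sum_distrib_left One_nat_def sum.atLeast1_atMost_eq)
  also have "\<dots> = sin (2 * real n * b) - sin (2 * real 0 * b)"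
    unfolding tele by (rule sum_lessThan_telescope)
  also have "2 * real n * b = real j * pi"
    using n by (simp add: b_def)
  finally show ?thesis
    using sin_gt_zero[OF b] by simp
qed

text \<open>Only the constant mode survives summation over the nodes, by
  \<open>sum_cos_theta_node\<close>.\<close>

lemma sum_S_fun:
  assumes "n \<ge> 1"
  shows "(\<Sum>k=1..n. S_fun n k t) = 1"
proof -
  let ?c = "\<lambda>j. cos (real j * (pi / (2 * real n))) * cos (real j * t)"
  have "(\<Sum>k=1..n. \<Sum>j=1..n-1. cos (real j * theta_node n k) * cos (real j * (pi / (2 * real n))) * cos (real j * t))
      = (\<Sum>j=1..n-1. (\<Sum>k=1..n. cos (real j * theta_node n k)) * ?c j)"
    by (subst sum.swap) (simp add: sum_distrib_right mult.assoc)
  also have "\<dots> = 0"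
    using sum_cos_theta_node by (intro sum.neutral ballI) auto
  finally have z: "(\<Sum>k=1..n. \<Sum>j=1..n-1. cos (real j * theta_node n k) * cos (real j * (pi / (2 * real n))) * cos (real j * t)) = 0" .
  have "(\<Sum>k=1..n. S_fun n k t) = (\<Sum>k=1..n. (1 + 2 * (\<Sum>j=1..n-1. cos (real j * theta_node n k) *
      cos (real j * (pi / (2 * real n))) * cos (real j * t))) / real n)"
    by (intro sum.cong) (auto simp: S_fun_cos_sum)
  also have "\<dots> = (\<Sum>k=1..n. 1 + 2 * (\<Sum>j=1..n-1. cos (real j * theta_node n k) *
      cos (real j * (pi / (2 * real n))) * cos (real j * t))) / real n"
    by (rule sum_divide_distrib[symmetric])
  also have "\<dots> = 1"
    using assms z by (simp add: sum.distrib flip: sum_distrib_left)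
  finally show ?thesis .
qed

section \<open>Trigonometric inequalities for the kernel bounds\<close>

text \<open>Both sides share the factor 2 sin ((b - a) / 2), which leaves |cos ((a + b) / 2)| \<le>
  cos ((b - a) / 2). This is the cross-multiplied form of the monotonicity of sin a / (c - cos
  a).\<close>

lemma sin_diff_scaled_le:
  fixes a b c :: real
  assumes "0 \<le> a" "a \<le> b" "b \<le> pi" "\<bar>c\<bar> \<le> 1"
  shows "c * (sin b - sin a) \<le> sin (b - a)"
proof -
  have d: "sin b - sin a = 2 * sin ((b - a) / 2) * cos ((b + a) / 2)"
    by (rule sin_diff_sin)
  have e: "sin (b - a) = 2 * sin ((b - a) / 2) * cos ((b - a) / 2)"
    using sin_double[of "(b - a) / 2"] by (simp only: mult_2 field_sum_of_halves)
  have s: "0 \<le> sin ((b - a) / 2)"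
    using assms by (intro sin_ge_zero) auto
  have "cos ((b + a) / 2) \<le> cos ((b - a) / 2)"
    using assms by (intro cos_monotone_0_pi_le) auto
  moreover have "cos (pi - (b + a) / 2) \<le> cos ((b - a) / 2)"
    using assms by (intro cos_monotone_0_pi_le) (auto simp: field_simps)
  ultimately have "\<bar>cos ((b + a) / 2)\<bar> \<le> cos ((b - a) / 2)"
    by (auto simp: abs_le_iff cos_diff)
  moreover have "c * cos ((b + a) / 2) \<le> \<bar>cos ((b + a) / 2)\<bar>"
    using assms(4) mult_right_mono[of "\<bar>c\<bar>" 1 "\<bar>cos ((b + a) / 2)\<bar>"]
      abs_ge_self[of "c * cos ((b + a) / 2)"] by (simp add: abs_mult)
  ultimately have "c * cos ((b + a) / 2) \<le> cos ((b - a) / 2)" by linarith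
  from mult_left_mono[OF this, of "2 * sin ((b - a) / 2)"] s show ?thesis
    unfolding d e by (simp add: mult_ac)
qed

text \<open>From cos u \<le> cos (2 h) \<le> 2 cos h - 1, replacing 1 by cos h loses at most half of
  1 - cos u = 2 (sin (u / 2))^2.\<close>

lemma cos_diff_ge_sin_squared:
  assumes "0 \<le> h" "h \<le> pi / 2" "2 * h \<le> u" "u \<le> 2 * pi - 2 * h"
  shows "(sin (u / 2))\<^sup>2 \<le> cos h - cos u"
proof -
  have "cos u \<le> cos (2 * h)"
  proof (cases "u \<le> pi")
    case True then show ?thesis using assms by (intro cos_monotone_0_pi_le) auto
  next
    case False
    have "cos (2 * pi - u) \<le> cos (2 * h)"
      using assms False by (intro cos_monotone_0_pi_le) auto
    then show ?thesis by (simp add: cos_diff)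
  qed
  also have "\<dots> = 2 * (cos h)\<^sup>2 - 1" by (rule cos_double_cos)
  finally have "cos u \<le> 2 * (cos h)\<^sup>2 - 1" .
  moreover have "(cos h)\<^sup>2 \<le> cos h"
    using assms cos_ge_zero[of h] mult_left_mono[of "cos h" 1 "cos h"] by (simp add: power2_eq_square)
  moreover have "cos u = 1 - 2 * (sin (u / 2))\<^sup>2"
    using cos_double_sin[of "u / 2"] by simp
  ultimately show ?thesis by linarith
qed

lemma abs_sin_half_ge:
  assumes "\<bar>x\<bar> \<le> pi"
  shows "\<bar>x\<bar> / pi \<le> \<bar>sin (x / 2)\<bar>"
proof -
  have "\<bar>x\<bar> / pi \<le> sin (\<bar>x\<bar> / 2)"
  proof -
    define y where "y = \<bar>x\<bar>/2"
    have y: "0 \<le> y" "y \<le> pi/2" using assms by (auto simp: y_def)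
    \<comment> \<open>Jordan's inequality: by concavity sine lies above its chord from 0 to \<pi> /
      2.\<close>
    have "concave_on {0..pi} sin"
      by (rule f''_le0_imp_concave[where f' = cos and f'' = "\<lambda>x. - sin x"])
         (auto intro!: derivative_eq_intros sin_ge_zero)
    then have "sin ((1 - y / (pi/2)) *\<^sub>R 0 + (y / (pi/2)) *\<^sub>R (pi/2)) \<ge> (1 - y / (pi/2)) * sin 0 + (y/(pi/2)) * sin (pi/2)"
      using y by (intro concave_onD) auto
    then show ?thesis using y by (simp add: y_def)
  qed
  also have "\<dots> \<le> \<bar>sin (x / 2)\<bar>"
    using abs_ge_self[of "sin (x/2)"] abs_ge_minus_self[of "sin (x/2)"] by (cases "x \<ge> 0") auto
  finally show ?thesis .
qed

section \<open>Closed form and decay of the kernels\<close>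

text \<open>The right side separates the dependence on t - a from that on t + a, so each factor can
  be bounded below by \<open>cos_diff_ge_sin_squared\<close>.\<close>

lemma cos_product_identity:
  fixes t a h :: real
  shows "(cos (t + h) - cos a) * (cos (t - h) - cos a) = (cos h - cos (t - a)) * (cos h - cos (t + a))"
proof -
  have "(cos (t + h) - cos a) * (cos (t - h) - cos a)
      = (cos t)\<^sup>2 * (cos h)\<^sup>2 - (sin t)\<^sup>2 * (sin h)\<^sup>2 - 2 * cos a * cos t * cos h + (cos a)\<^sup>2"
    by (simp add: cos_add cos_diff power2_eq_square algebra_simps)
  moreover have "(cos h - cos (t - a)) * (cos h - cos (t + a))
      = (cos h)\<^sup>2 - 2 * cos a * cos t * cos h + (cos t)\<^sup>2 * (cos a)\<^sup>2 - (sin t)\<^sup>2 * (sin a)\<^sup>2"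
    by (simp add: cos_add cos_diff power2_eq_square algebra_simps)
  ultimately show ?thesis
    by (simp add: sin_squared_eq algebra_simps)
qed

text \<open>The shifts by \<open>h\<close> turn cos (n t) into sin (n t) and its negative, so the
  average is a difference of two quotients. Their common numerator A - B = 2 sin t sin h gains a
  factor of order 1 / n over a denominator now quadratic.\<close>

lemma S_fun_factored:
  assumes k: "1 \<le> k" "k \<le> n" and h: "h = pi / (2 * real n)"
    and ne: "cos (t + h) \<noteq> cos (theta_node n k)" "cos (t - h) \<noteq> cos (theta_node n k)"
  shows "S_fun n k t = (-1) ^ k * (sin (real n * t) * sin t * sin h / real n) *
    (sin (theta_node n k) / ((cos (t + h) - cos (theta_node n k)) * (cos (t - h) - cos (theta_node n k))))"
proof -
  let ?a = "theta_node n k"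
  have n: "real n > 0" using k by simp
  have nh: "real n * h = pi / 2" using n by (simp add: h)
  define A B where "A = cos (t - h) - cos ?a" and "B = cos (t + h) - cos ?a"
  have AB: "A \<noteq> 0" "B \<noteq> 0" "A - B = 2 * sin t * sin h"
    using ne by (auto simp: A_def B_def cos_add cos_diff)
  have "cos (real n * (t - h)) = sin (real n * t)" "cos (real n * (t + h)) = - sin (real n * t)"
    by (simp_all add: right_diff_distrib distrib_left nh cos_diff cos_add)
  then have "S_fun n k t = 1 / 2 * ((-1) ^ (k + 1) * (sin (real n * t) * sin ?a) / (real n * A)
      + (-1) ^ (k + 1) * (- sin (real n * t) * sin ?a) / (real n * B))"
    using ne unfolding S_fun_def P_fun_def P_quot_def h[symmetric] A_def B_def by simp
  also have "\<dots> = (-1) ^ k * (sin (real n * t) * sin ?a / real n) * ((A - B) / (2 * (A * B)))"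
    using AB(1,2) n by (simp add: field_simps)
  finally show ?thesis
    unfolding AB(3) by (simp add: A_def B_def mult_ac)
qed

text \<open>The quotient of sines is kept although it is at most 1: near the endpoints it supplies
  the factor sin t needed in \<open>abs_S_fun_sin_node_le\<close>.\<close>

lemma abs_S_fun_le_far:
  assumes k: "1 \<le> k" "k \<le> n" and t: "0 \<le> t" "t \<le> pi" and far: "pi / real n \<le> \<bar>t - theta_node n k\<bar>"
  shows "0 < sin ((t + theta_node n k) / 2)"
    and "\<bar>S_fun n k t\<bar> \<le> 32 / (1 + (real n * (t - theta_node n k))\<^sup>2) *
      (sin t * sin (theta_node n k) / (sin ((t + theta_node n k) / 2))\<^sup>2)"
proof -
  let ?a = "theta_node n k"
  define h \<phi> \<sigma> where "h = pi / (2 * real n)" and "\<phi> = \<bar>t - ?a\<bar>" and "\<sigma> = t + ?a"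
  have n: "real n \<ge> 1" using k by simp
  have a: "0 < ?a" "?a < pi" using theta_node_bounds[OF k] by auto
  have h2: "2 * h = pi / real n" by (simp add: h_def)
  have h: "0 < h" "h \<le> pi / 2"
    using n by (auto simp: h_def field_simps)
  have far': "2 * h \<le> \<phi>" using far by (simp add: h2 \<phi>_def)
  have \<phi>: "\<phi> \<le> pi" "0 < \<phi>" using t a far' h by (auto simp: \<phi>_def)
  have \<phi>': "\<phi> \<le> 2 * pi - 2 * h" using \<phi> h by linarith
  \<comment> \<open>A point of [0, \<pi>] is no closer to the reflected nodes -\<theta>_k and 2
    \<pi> - \<theta>_k than to \<theta>_k.\<close>
  have \<sigma>: "2 * h \<le> \<sigma>" "\<sigma> \<le> 2 * pi - 2 * h"
    using far' t a by (auto simp: \<phi>_def \<sigma>_def abs_if split: if_splits)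
  show sp: "0 < sin ((t + ?a) / 2)"
    using \<sigma> h by (intro sin_gt_zero) (auto simp: \<sigma>_def)
  have c1: "(\<phi> / pi)\<^sup>2 \<le> cos h - cos (t - ?a)"
  proof -
    have "(\<phi> / pi)\<^sup>2 \<le> (sin (\<phi> / 2))\<^sup>2"
      using abs_sin_half_ge[of \<phi>] \<phi> by (subst abs_le_square_iff[symmetric]) auto
    also have "\<dots> \<le> cos h - cos \<phi>"
      using h far' \<phi>' by (intro cos_diff_ge_sin_squared) auto
    finally show ?thesis by (simp add: \<phi>_def)
  qed
  have c2: "(sin (\<sigma> / 2))\<^sup>2 \<le> cos h - cos (t + ?a)"
    using h \<sigma> unfolding \<sigma>_def by (intro cos_diff_ge_sin_squared) auto
  define A B where "A = cos h - cos (t - ?a)" and "B = cos h - cos (t + ?a)"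
  have AB: "0 < (\<phi> / pi)\<^sup>2" "(\<phi> / pi)\<^sup>2 \<le> A" "0 < (sin (\<sigma> / 2))\<^sup>2" "(sin (\<sigma> / 2))\<^sup>2 \<le> B"
    using c1 c2 sp \<phi> by (auto simp: A_def B_def \<sigma>_def)
  then have AB': "0 < A" "0 < B" by (blast intro: less_le_trans)+
  then have "A * B \<noteq> 0" by simp
  then have ne: "cos (t + h) \<noteq> cos ?a" "cos (t - h) \<noteq> cos ?a"
    using cos_product_identity[of t h ?a] by (auto simp: A_def B_def)
  have st: "0 \<le> sin t" using t by (intro sin_ge_zero) auto
  have sa: "0 < sin ?a" using a by (intro sin_gt_zero) auto
  have sh: "0 \<le> sin h" "sin h \<le> h" using h by (auto intro!: sin_ge_zero sin_x_le_x)
  have "\<bar>S_fun n k t\<bar> = \<bar>sin (real n * t)\<bar> * (sin t * sin h / real n * (sin ?a / (A * B)))"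
    unfolding S_fun_factored[OF k h_def ne] cos_product_identity A_def[symmetric] B_def[symmetric]
    using st sa sh AB' by (simp add: abs_mult power_abs)
  also have "\<dots> \<le> 1 * (sin t * sin h / real n * (sin ?a / (A * B)))"
    using st sa sh AB' n by (intro mult_right_mono) auto
  also have "\<dots> \<le> sin t * h / real n * (sin ?a / ((\<phi> / pi)\<^sup>2 * (sin (\<sigma> / 2))\<^sup>2))"
    unfolding mult_1 using st sa sh AB AB' h n
    by (intro mult_mono divide_right_mono mult_left_mono divide_left_mono mult_pos_pos) auto
  also have "\<dots> = (h * pi\<^sup>2 / (real n * \<phi>\<^sup>2)) * (sin t * sin ?a / (sin (\<sigma> / 2))\<^sup>2)"
    by (simp add: power_divide mult_ac)
  also have "\<dots> \<le> 32 / (1 + (real n * (t - ?a))\<^sup>2) * (sin t * sin ?a / (sin (\<sigma> / 2))\<^sup>2)"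
  proof (rule mult_right_mono)
    have np: "1 \<le> real n * \<phi>"
      using far n pi_gt3 by (simp add: \<phi>_def field_simps)
    have sq: "(real n * (t - ?a))\<^sup>2 = (real n * \<phi>)\<^sup>2"
      by (simp add: \<phi>_def power_mult_distrib)
    \<comment> \<open>This fixes the constant 32: the factor \<pi>^3 / 2 is at most 16, and passing
      from y to 1 + y with y \<ge> 1 costs another factor 2.\<close>
    have "pi ^ 3 \<le> (63 / 20 :: real) ^ 3"
      using pi_approx by (intro power_mono) auto
    then have p3: "pi ^ 3 \<le> 32" by (simp add: power3_eq_cube)
    have "h * pi\<^sup>2 / (real n * \<phi>\<^sup>2) = (pi ^ 3 / 2) / (real n * \<phi>)\<^sup>2"
      using n \<phi> by (simp add: h_def field_simps power2_eq_square power3_eq_cube)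
    also have "\<dots> \<le> 16 / (real n * \<phi>)\<^sup>2"
      using p3 by (intro divide_right_mono) auto
    also have "\<dots> \<le> 32 / (1 + (real n * \<phi>)\<^sup>2)"
    proof -
      have "1 \<le> (real n * \<phi>)\<^sup>2" using np by (rule one_le_power)
      moreover have "16 / y \<le> 32 / (1 + y)" if "1 \<le> y" for y :: real
        using that by (simp add: field_simps)
      ultimately show ?thesis by blast
    qed
    finally show "h * pi\<^sup>2 / (real n * \<phi>\<^sup>2) \<le> 32 / (1 + (real n * (t - ?a))\<^sup>2)" unfolding sq .
  qed (use st sa in auto)
  finally show "\<bar>S_fun n k t\<bar> \<le> 32 / (1 + (real n * (t - ?a))\<^sup>2) *
      (sin t * sin ?a / (sin ((t + ?a) / 2))\<^sup>2)"
    by (simp add: \<sigma>_def)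
qed

lemma abs_sin_add_le: "\<bar>sin (x + y)\<bar> \<le> \<bar>sin x\<bar> + \<bar>sin y\<bar>" for x y :: real
proof -
  have "\<bar>sin (x + y)\<bar> \<le> \<bar>sin x\<bar> * \<bar>cos y\<bar> + \<bar>cos x\<bar> * \<bar>sin y\<bar>"
    unfolding sin_add abs_mult[symmetric] by (rule abs_triangle_ineq)
  also have "\<dots> \<le> \<bar>sin x\<bar> * 1 + 1 * \<bar>sin y\<bar>"
    by (intro add_mono mult_left_mono mult_right_mono) auto
  finally show ?thesis by simp
qed

lemma sin_add_sin_le:
  assumes "0 \<le> s" "s \<le> pi" "0 \<le> t" "t \<le> pi"
  shows "sin s + sin t \<le> 2 * sin ((s + t) / 2)"
proof -
  have "0 \<le> sin ((s + t) / 2)" using assms by (intro sin_ge_zero) auto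
  then show ?thesis
    using mult_left_mono[of "cos ((s - t) / 2)" 1 "2 * sin ((s + t) / 2)"] unfolding sin_plus_sin by simp
qed

lemma abs_S_fun_le:
  assumes k: "1 \<le> k" "k \<le> n" and t: "0 \<le> t" "t \<le> pi"
  shows "\<bar>S_fun n k t\<bar> \<le> 32 / (1 + (real n * (t - theta_node n k))\<^sup>2)"
proof (cases "pi / real n \<le> \<bar>t - theta_node n k\<bar>")
  case True
  let ?a = "theta_node n k"
  have a: "0 < ?a" "?a < pi" using theta_node_bounds[OF k] by auto
  note far = abs_S_fun_le_far[OF k t True]
  have s: "0 \<le> sin t" "0 \<le> sin ?a" "sin t + sin ?a \<le> 2 * sin ((t + ?a) / 2)"
    using t a by (auto intro!: sin_ge_zero sin_add_sin_le)
  \<comment> \<open>The AM-GM inequality, followed by concavity of sine, bounds the quotient of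
    sines by 1.\<close>
  have "4 * (sin t * sin ?a) \<le> (sin t + sin ?a)\<^sup>2"
    using zero_le_power2[of "sin t - sin ?a"] by (simp add: power2_eq_square algebra_simps)
  also have "\<dots> \<le> (2 * sin ((t + ?a) / 2))\<^sup>2"
    using s by (intro power_mono) auto
  finally have "sin t * sin ?a / (sin ((t + ?a) / 2))\<^sup>2 \<le> 1"
    using far(1) by (simp add: power_mult_distrib divide_le_eq)
  from mult_left_mono[OF this, of "32 / (1 + (real n * (t - ?a))\<^sup>2)"] far(2)
  show ?thesis by (simp add: add_nonneg_nonneg)
next
  case False
  then have "real n * \<bar>t - theta_node n k\<bar> \<le> 3.15"
    using k pi_approx by (simp add: field_simps)
  then have "\<bar>real n * (t - theta_node n k)\<bar> \<le> 3.15"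
    by (simp add: abs_mult)
  then have "(real n * (t - theta_node n k))\<^sup>2 \<le> 3.15\<^sup>2"
    by (subst abs_le_square_iff[symmetric]) simp
  \<comment> \<open>With 15 the claimed bound is at least 32 / 16 = 2, which is the crude bound on
    the kernel.\<close>
  then have "(real n * (t - theta_node n k))\<^sup>2 \<le> 15" by (simp add: power2_eq_square[of "63/20"])
  then have "(2::real) \<le> 32 / (1 + (real n * (t - theta_node n k))\<^sup>2)"
    by (simp add: le_divide_eq add_pos_nonneg)
  with abs_S_fun_le_2[OF k, of t] show ?thesis by linarith
qed

text \<open>The weight \<pi> / (2 n) * sin \<theta>_k measures the gap between cosines of adjacent
  nodes. It may be much larger than sin t / n for far nodes, but the quotient of sines in
  \<open>abs_S_fun_le_far\<close> converts sin \<theta>_k into sin t.\<close>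

lemma abs_S_fun_sin_node_le:
  assumes k: "1 \<le> k" "k \<le> n" and t: "0 \<le> t" "t \<le> pi"
  shows "\<bar>S_fun n k t\<bar> * (pi / (2 * real n) * sin (theta_node n k)) \<le>
    256 / (1 + (real n * (t - theta_node n k))\<^sup>2) * (sin t / real n + 1 / (real n)\<^sup>2)"
proof -
  let ?a = "theta_node n k" and ?d = "sin t / real n + 1 / (real n)\<^sup>2"
  let ?D = "1 + (real n * (t - ?a))\<^sup>2"
  have n: "real n \<ge> 1" using k by simp
  have a: "0 < ?a" "?a < pi" using theta_node_bounds[OF k] by auto
  have s: "0 \<le> sin t" "0 \<le> sin ?a" "sin t + sin ?a \<le> 2 * sin ((t + ?a) / 2)"
    using t a by (auto intro!: sin_ge_zero sin_add_sin_le)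
  have D: "?D > 0" by (simp add: add_pos_nonneg)
  have d: "sin t / real n \<le> ?d" "1 / (real n)\<^sup>2 \<le> ?d" using s n by auto
  show ?thesis
  proof (cases "pi / real n \<le> \<bar>t - ?a\<bar>")
    case True
    note far = abs_S_fun_le_far[OF k t True]
    have sq: "(sin ?a)\<^sup>2 \<le> (2 * sin ((t + ?a) / 2))\<^sup>2"
      using s by (intro power_mono) auto
    then have r: "(sin ?a)\<^sup>2 / (sin ((t + ?a) / 2))\<^sup>2 \<le> 4"
      using far(1) by (simp add: power_mult_distrib divide_le_eq)
    have "\<bar>S_fun n k t\<bar> * (pi / (2 * real n) * sin ?a) \<le>
        32 / ?D * (sin t * sin ?a / (sin ((t + ?a) / 2))\<^sup>2) * (pi / (2 * real n) * sin ?a)"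
      using far(2) s n by (intro mult_right_mono) auto
    also have "\<dots> = 32 / ?D * (pi / 2 * (sin t / real n) * ((sin ?a)\<^sup>2 / (sin ((t + ?a) / 2))\<^sup>2))"
      by (simp add: power2_eq_square mult_ac)
    also have "\<dots> \<le> 32 / ?D * (2 * ?d * 4)"
      using D r d s n pi_half_less_two
      by (intro mult_left_mono mult_mono) auto
    finally show ?thesis by simp
  next
    case False
    \<comment> \<open>For a close node sin \<theta>_k exceeds sin t by less than \<pi> / n, and this
      excess is paid for by the term 1 / n^2.\<close>
    have "sin ?a \<le> sin t + \<bar>t - ?a\<bar>"
      using abs_sin_add_le[of t "?a - t"] abs_sin_x_le_abs_x[of "?a - t"] s by (simp add: abs_minus_commute)
    then have "sin ?a \<le> sin t + pi / real n" using False by linarith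
    then have "pi / (2 * real n) * sin ?a \<le> pi / (2 * real n) * (sin t + pi / real n)"
      using n by (intro mult_left_mono) auto
    also have "\<dots> = pi / 2 * (sin t / real n) + pi\<^sup>2 / 2 * (1 / (real n)\<^sup>2)"
      using n by (simp add: field_simps power2_eq_square)
    also have "\<dots> \<le> 8 * (sin t / real n) + 8 * (1 / (real n)\<^sup>2)"
    proof (intro add_mono mult_right_mono)
      show "pi\<^sup>2 / 2 \<le> 8" using power_mono[of pi 4 2] pi_less_4 by simp
    qed (use s pi_less_4 in auto)
    finally have "pi / (2 * real n) * sin ?a \<le> 8 * ?d" by simp
    from mult_mono[OF abs_S_fun_le[OF k t] this] s n show ?thesis by (simp add: D less_imp_le)
  qed
qed

section \<open>Monotonicity of the kernels in the node\<close>

text \<open>The quotient is a product of two nonnegative decreasing factors, one of them by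
  \<open>sin_diff_scaled_le\<close>. For p and q equal to cos (t + h) and cos (t - h) it is the
  node-dependent part of \<open>S_fun_factored\<close>, seen from nodes to the right of
  \<open>t\<close>.\<close>

lemma sin_quotient_decreasing:
  assumes ab: "0 \<le> a" "a \<le> b" "b \<le> pi" and p: "\<bar>p\<bar> \<le> 1" "cos a < p" and q: "cos a < q"
  shows "sin b / ((p - cos b) * (q - cos b)) \<le> sin a / ((p - cos a) * (q - cos a))"
proof -
  have c: "cos b \<le> cos a" using ab by (intro cos_monotone_0_pi_le) auto
  have "sin b * (p - cos a) \<le> sin a * (p - cos b)"
    using sin_diff_scaled_le[OF ab p(1)] by (simp add: sin_diff algebra_simps)
  then have "sin b / (p - cos b) \<le> sin a / (p - cos a)"
    using c p by (simp add: field_simps)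
  moreover have "1 / (q - cos b) \<le> 1 / (q - cos a)"
    using c q by (simp add: field_simps)
  moreover have "0 \<le> sin a / (p - cos a)" "0 \<le> 1 / (q - cos b)"
    using ab c p q by (auto intro!: divide_nonneg_nonneg sin_ge_zero)
  ultimately have "sin b / (p - cos b) * (1 / (q - cos b)) \<le> sin a / (p - cos a) * (1 / (q - cos a))"
    by (intro mult_mono)
  then show ?thesis by simp
qed

text \<open>The reflection a \<mapsto> \<pi> - a reduces this to the decreasing case. It serves the
  nodes to the left of \<open>t\<close>.\<close>

lemma sin_quotient_increasing:
  assumes ab: "0 \<le> a" "a \<le> b" "b \<le> pi" and p: "\<bar>p\<bar> \<le> 1" "p < cos b" and q: "q < cos b"
  shows "sin a / ((p - cos a) * (q - cos a)) \<le> sin b / ((p - cos b) * (q - cos b))"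
proof -
  have "- cos (pi - a) = cos a" "- cos (pi - b) = cos b" "sin (pi - a) = sin a" "sin (pi - b) = sin b"
    by (simp_all add: cos_diff sin_diff)
  moreover have "(p - x) * (q - x) = (- p - - x) * (- q - - x)" for x
    by (simp add: algebra_simps)
  ultimately show ?thesis
    using sin_quotient_decreasing[of "pi - b" "pi - a" "- p" "- q"] ab p q by auto
qed

subsection \<open>The interpolation process\<close>

lemma theta_node_diff:
  "theta_node n k - theta_node n m = (real k - real m) * (pi / real n)"
  by (cases "n = 0") (simp_all add: theta_node_def field_simps)

text \<open>The arguments may leave [0, \<pi>], as happens for t - h and t + h near the
  endpoints.\<close>

lemma cos_less_cos:
  fixes a b :: real
  assumes "0 < b - a" "b - a < 2 * pi" "0 < a + b" "a + b < 2 * pi"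
  shows "cos b < cos a"
proof -
  have "0 < sin ((a + b) / 2)" "0 < sin ((b - a) / 2)"
    using assms by (intro sin_gt_zero; simp)+
  then have "0 < cos a - cos b" unfolding cos_diff_cos by simp
  then show ?thesis by simp
qed

lemma exists_close_theta_node:
  assumes n: "1 \<le> n" and t: "0 \<le> t" "t \<le> pi"
  obtains m where "1 \<le> m" "m \<le> n" "\<bar>theta_node n m - t\<bar> \<le> pi / (2 * real n)"
proof -
  define q where "q = real n * t / pi"
  have q: "0 \<le> q" "q \<le> real n" using n t by (auto simp: q_def field_simps)
  have "\<exists>m. 1 \<le> m \<and> m \<le> n \<and> \<bar>real m - 1 / 2 - q\<bar> \<le> 1 / 2"
  proof (cases "q = 0")
    \<comment> \<open>For t = 0 the ceiling below would give the index 0, which is not a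
      node.\<close>
    case True
    then show ?thesis using n by (intro exI[of _ 1]) auto
  next
    case False
    define c where "c = nat \<lceil>q\<rceil>"
    have "0 < \<lceil>q\<rceil>" "\<lceil>q\<rceil> \<le> int n" using q False by (auto simp: ceiling_le_iff)
    then have "1 \<le> c" "c \<le> n" "q \<le> real c" "real c - 1 < q"
      using ceiling_correct[of q] by (auto simp: c_def nat_le_iff le_nat_iff)
    then show ?thesis
      by (intro exI[of _ c] conjI) (assumption, assumption, unfold abs_le_iff, linarith)
  qed
  then obtain m where m: "1 \<le> m" "m \<le> n" "\<bar>real m - 1 / 2 - q\<bar> \<le> 1 / 2" by blast
  have "theta_node n m - t = (real m - 1 / 2 - q) * (pi / real n)"
    using n by (simp add: theta_node_def q_def field_simps)
  then have "\<bar>theta_node n m - t\<bar> = \<bar>real m - 1 / 2 - q\<bar> * (pi / real n)"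
    by (simp add: abs_mult)
  also have "\<dots> \<le> 1 / 2 * (pi / real n)"
    using m(3) by (intro mult_right_mono) auto
  finally show thesis using that m by simp
qed

text \<open>For k distinct from m the scaled distance is at least (|k - m| - 1/2) \<pi> \<ge> |k -
  m|. Kernel bounds thus turn into the summands of
  \<open>sum_inverse_square_shifted_le\<close>.\<close>

lemma node_distance_ge:
  assumes n: "1 \<le> n" and m: "\<bar>theta_node n m - t\<bar> \<le> pi / (2 * real n)"
  shows "(real k - real m)\<^sup>2 \<le> (real n * (t - theta_node n k))\<^sup>2"
proof -
  define h where "h = pi / (2 * real n)"
  have n0: "real n \<ge> 1" using n by simp
  have h: "0 < h" "pi / real n = 2 * h" using n0 by (auto simp: h_def)
  have "\<bar>real k - real m\<bar> \<le> real n * \<bar>t - theta_node n k\<bar>"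
  proof (cases "k = m")
    case False
    then have far: "1 \<le> \<bar>real k - real m\<bar>" by linarith
    have "\<bar>real k - real m\<bar> * (2 * h) - h \<le> \<bar>t - theta_node n k\<bar>"
    proof -
      have "\<bar>theta_node n k - theta_node n m\<bar> = \<bar>real k - real m\<bar> * (2 * h)"
        unfolding theta_node_diff h(2) abs_mult using h by simp
      then show ?thesis using m[folded h_def] by linarith
    qed
    then have le: "real n * (\<bar>real k - real m\<bar> * (2 * h) - h) \<le> real n * \<bar>t - theta_node n k\<bar>"
      by (rule mult_left_mono) simp
    have "\<bar>real k - real m\<bar> \<le> (2 * \<bar>real k - real m\<bar> - 1) * 1"
      using far by simp
    also have "\<dots> \<le> (2 * \<bar>real k - real m\<bar> - 1) * (pi / 2)"
      using far pi_gt3 by (intro mult_left_mono) auto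
    also have "\<dots> = real n * (\<bar>real k - real m\<bar> * (2 * h) - h)"
      using n0 by (simp add: h_def field_simps)
    also note le
    finally show ?thesis .
  qed simp
  then show ?thesis
    by (subst abs_le_square_iff[symmetric]) (simp add: abs_mult)
qed

lemma abs_cos_diff_adjacent_node_le:
  assumes k: "1 \<le> k" "k \<le> n" and s: "s = 1 \<or> s = -1"
  shows "\<bar>cos (theta_node n k) - cos (theta_node n k + s * (pi / real n))\<bar> \<le>
    4 * (pi / (2 * real n) * sin (theta_node n k))"
proof -
  let ?a = "theta_node n k"
  define h where "h = pi / (2 * real n)"
  have n: "real n \<ge> 1" using k by simp
  have h: "0 < h" "h \<le> pi / 2" "pi / real n = 2 * h" using n by (auto simp: h_def field_simps)
  have a: "h \<le> ?a" "?a \<le> pi - h"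
    using theta_node_diff[of n k 1] theta_node_diff[of n n k] k n
    by (auto simp: theta_node_def h_def field_simps)
  \<comment> \<open>All nodes keep distance at least \<open>h\<close> from 0 and \<pi>. Hence the
    sine at the midpoint of the step is at most 2 sin \<theta>_k.\<close>
  have sa: "sin h \<le> sin ?a"
  proof (cases "?a \<le> pi / 2")
    case True
    then show ?thesis using a h by (intro sin_monotone_2pi_le) auto
  next
    case False
    then have "sin h \<le> sin (pi - ?a)" using a h by (intro sin_monotone_2pi_le) auto
    then show ?thesis by simp
  qed
  have sh: "0 \<le> sin h" "sin h \<le> h" using h by (auto intro!: sin_ge_zero sin_x_le_x)
  have "(?a + (?a + s * (2 * h))) / 2 = ?a + s * h" "((?a + s * (2 * h)) - ?a) / 2 = s * h" by auto
  then have "cos ?a - cos (?a + s * (2 * h)) = 2 * sin (?a + s * h) * sin (s * h)"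
    by (simp only: cos_diff_cos)
  then have "\<bar>cos ?a - cos (?a + s * (2 * h))\<bar> = 2 * \<bar>sin (?a + s * h)\<bar> * sin h"
    using s sh by (auto simp: abs_mult)
  also have "\<dots> \<le> 2 * (sin ?a + sin h) * h"
    using abs_sin_add_le[of ?a "s * h"] s sh sa by (intro mult_mono) auto
  also have "\<dots> \<le> 2 * (sin ?a + sin ?a) * h"
    using sa h by (intro mult_right_mono) auto
  also have "\<dots> = 4 * (h * sin ?a)" by simp
  finally show ?thesis unfolding h_def[symmetric] h(3) .
qed

lemma abs_cos_diff_le:
  fixes t u :: real
  assumes "0 \<le> sin t"
  shows "\<bar>cos (t + u) - cos t\<bar> \<le> \<bar>u\<bar> * sin t + u\<^sup>2"
proof -
  have "((t + u) + t) / 2 = t + u / 2" "(t - (t + u)) / 2 = - u / 2" by auto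
  then have "cos (t + u) - cos t = 2 * sin (t + u / 2) * sin (- u / 2)"
    by (simp only: cos_diff_cos)
  then have "\<bar>cos (t + u) - cos t\<bar> = 2 * \<bar>sin (t + u / 2)\<bar> * \<bar>sin (u / 2)\<bar>"
    by (simp add: abs_mult)
  also have "\<dots> \<le> 2 * (sin t + \<bar>u\<bar> / 2) * (\<bar>u\<bar> / 2)"
    using abs_sin_add_le[of t "u / 2"] abs_sin_x_le_abs_x[of "u / 2"] assms
    by (intro mult_mono) auto
  also have "\<dots> \<le> \<bar>u\<bar> * sin t + u\<^sup>2"
    by (simp add: field_simps power2_eq_square)
  finally show ?thesis .
qed

text \<open>As the kernels sum to 1, the error is the sum of \<open>S k * e k\<close>. The few nodes
  near \<open>t\<close> are estimated absolutely, and the two sides by the alternating sum lemmas,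
  all with the same majorant \<open>b\<close>.\<close>

lemma grunwald_approximation:
  assumes g: "continuous_on {-1..1} g" and n: "1 \<le> n" and t: "0 \<le> t" "t \<le> pi"
    and d: "d = sin t / real n + 1 / (real n)\<^sup>2"
  shows "\<bar>(\<Sum>k=1..n. S_fun n k t * g (cos (theta_node n k))) - g (cos t)\<bar> \<le>
    16800 * modulus_of_continuity {-1..1} g d"
proof -
  define \<omega> where "\<omega> = modulus_of_continuity {-1..1} g d"
  define S where "S k = S_fun n k t" for k
  define x where "x k = cos (theta_node n k)" for k
  define e where "e k = g (x k) - g (cos t)" for k
  have n0: "real n \<ge> 1" using n by simp
  have st: "0 \<le> sin t" using t by (intro sin_ge_zero) auto
  have d0: "d > 0" using st n0 by (auto simp: d intro!: add_nonneg_pos)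
  have w0: "0 \<le> \<omega>" unfolding \<omega>_def using g d0 by (intro modulus_nonneg) auto
  have cI: "cos y \<in> {-1..1}" for y :: real by auto
  obtain m where m: "1 \<le> m" "m \<le> n" "\<bar>theta_node n m - t\<bar> \<le> pi / (2 * real n)"
    using exists_close_theta_node[OF n t] .
  define D where "D k = 1 + (real n * (t - theta_node n k))\<^sup>2" for k
  \<comment> \<open>The constant 2100 covers both 32 * 65 = 2080 in \<open>near\<close> and 32 +
    1024 = 1056 in \<open>adj\<close>; summing over the nodes multiplies it by 8.\<close>
  define b where "b k = 2100 * \<omega> / D k" for k
  have D: "D k > 0" for k by (simp add: D_def add_pos_nonneg)
  have S1: "\<bar>S k\<bar> \<le> 32 / D k" if "1 \<le> k" "k \<le> n" for k
    using abs_S_fun_le[OF that t] by (simp add: S_def D_def)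
  have S2: "\<bar>S k\<bar> * (pi / (2 * real n) * sin (theta_node n k)) \<le> 256 / D k * d" if "1 \<le> k" "k \<le> n" for k
    using abs_S_fun_sin_node_le[OF that t] by (simp add: S_def D_def d)
  have adj: "\<bar>S k\<bar> * \<bar>e k - e j\<bar> \<le> b k"
    if k: "1 \<le> k" "k \<le> n" and j: "j = Suc k \<or> k = Suc j" for k j
  proof -
    define \<Delta> where "\<Delta> = \<bar>x k - x j\<bar>"
    have "theta_node n j = theta_node n k + (real j - real k) * (pi / real n)"
      using theta_node_diff[of n j k] by simp
    then have "\<Delta> \<le> 4 * (pi / (2 * real n) * sin (theta_node n k))"
      unfolding \<Delta>_def x_def using abs_cos_diff_adjacent_node_le[OF k, of "real j - real k"] j by auto
    then have "\<bar>S k\<bar> * \<Delta> \<le> 4 * (\<bar>S k\<bar> * (pi / (2 * real n) * sin (theta_node n k)))"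
      by (subst mult.left_commute) (rule mult_left_mono, auto)
    also have "\<dots> \<le> 4 * (256 / D k * d)" using S2[OF k] by (rule mult_left_mono) simp
    finally have S\<Delta>: "\<bar>S k\<bar> * (\<Delta> / d) \<le> 1024 / D k" using d0 by (simp add: field_simps)
    have "\<bar>e k - e j\<bar> \<le> (1 + \<Delta> / d) * \<omega>"
      unfolding \<omega>_def \<Delta>_def using abs_diff_le_modulus_scaled[OF g cI cI d0]
      by (simp add: e_def x_def)
    then have "\<bar>S k\<bar> * \<bar>e k - e j\<bar> \<le> \<bar>S k\<bar> * ((1 + \<Delta> / d) * \<omega>)"
      by (intro mult_left_mono) auto
    also have "\<dots> = (\<bar>S k\<bar> + \<bar>S k\<bar> * (\<Delta> / d)) * \<omega>"
      by (simp add: algebra_simps)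
    also have "\<dots> \<le> (32 / D k + 1024 / D k) * \<omega>"
      using S1[OF k] S\<Delta> w0 by (intro mult_right_mono add_mono)
    also have "\<dots> \<le> b k"
      using D[of k] w0 by (simp add: b_def field_simps)
    finally show ?thesis .
  qed
  \<comment> \<open>The range includes k = m + 2 and k = m - 2 because they give the boundary terms
    of the two alternating sums.\<close>
  have near: "\<bar>S k\<bar> * \<bar>e k\<bar> \<le> b k" if k: "1 \<le> k" "k \<le> n" and km: "k \<le> m + 2" "m \<le> k + 2" for k
  proof -
    define u where "u = theta_node n k - t"
    have "\<bar>theta_node n k - theta_node n m\<bar> \<le> 2 * (pi / real n)"
      unfolding theta_node_diff abs_mult using km by (intro mult_mono) auto
    moreover have "\<bar>u\<bar> \<le> \<bar>theta_node n k - theta_node n m\<bar> + \<bar>theta_node n m - t\<bar>"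
      by (simp add: u_def)
    ultimately have "\<bar>u\<bar> \<le> 2 * (pi / real n) + pi / (2 * real n)"
      using m(3) by linarith
    also have "\<dots> = (5 / 2 * pi) * (1 / real n)" by simp
    also have "\<dots> \<le> (5 / 2 * 3.2) * (1 / real n)"
      using pi_approx by (intro mult_right_mono) auto
    finally have u: "\<bar>u\<bar> \<le> 8 / real n" by simp
    have "\<bar>x k - cos t\<bar> \<le> \<bar>u\<bar> * sin t + u\<^sup>2"
      using abs_cos_diff_le[OF st, of u] by (simp add: u_def x_def)
    also have "\<dots> \<le> 8 / real n * sin t + (8 / real n)\<^sup>2"
      using u st by (intro add_mono mult_right_mono abs_le_square_iff[THEN iffD1]) auto
    also have "\<dots> \<le> 8 * (sin t / real n) + 64 * (1 / (real n)\<^sup>2)"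
      by (simp add: power_divide)
    also have "\<dots> \<le> 64 * d"
      using mult_right_mono[of 8 64 "sin t / real n"] st by (simp add: d distrib_left)
    finally have "\<bar>x k - cos t\<bar> \<le> 64 * d" .
    then have "\<bar>x k - cos t\<bar> / d \<le> 64" using d0 by (simp add: field_simps)
    then have "\<bar>e k\<bar> \<le> (1 + 64) * \<omega>"
      unfolding e_def
      by (intro order_trans[OF abs_diff_le_modulus_scaled[OF g _ cI d0]])
        (auto simp: x_def \<omega>_def[symmetric] intro!: mult_right_mono w0)
    from mult_mono[OF S1[OF k] this] D[of k] w0
    show ?thesis by (simp add: b_def field_simps)
  qed
  have mid: "\<bar>S k * e k\<bar> \<le> b k" if "1 \<le> k" "k \<le> n" "k \<le> m + 2" "m \<le> k + 2" for k
    using near[OF that] by (simp add: abs_mult)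
  \<comment> \<open>\<open>S k\<close> is split into its sign (-1)^k, a factor \<tau> common to all
    nodes and the node-dependent \<open>F k\<close>. Where \<open>F k\<close> is nonnegative, the
    signs alternate and |S k| is monotone as soon as \<open>F k\<close> is.\<close>
  define \<tau> where "\<tau> = sin (real n * t) * sin t * sin (pi / (2 * real n)) / real n"
  define F where "F k = sin (theta_node n k) /
    ((cos (t + pi / (2 * real n)) - x k) * (cos (t - pi / (2 * real n)) - x k))" for k
  have S_eq: "S k = (-1) ^ k * \<tau> * F k"
    if "1 \<le> k" "k \<le> n" "cos (t + pi / (2 * real n)) \<noteq> x k" "cos (t - pi / (2 * real n)) \<noteq> x k" for k
    using S_fun_factored[OF that(1,2) refl that(3,4)[unfolded x_def]] by (simp add: S_def \<tau>_def F_def x_def)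
  have S_alt: "S k = (-1) ^ k * sgn \<tau> * \<bar>S k\<bar>" "\<bar>S k\<bar> = \<bar>\<tau>\<bar> * F k" if "S k = (-1) ^ k * \<tau> * F k" "0 \<le> F k" for k
    unfolding that(1) using that(2) by (auto simp: abs_mult power_abs sgn_if)
  define h where "h = pi / (2 * real n)"
  have h: "0 < h" "h \<le> pi / 2" "pi / real n = 2 * h" using n0 by (auto simp: h_def field_simps)
  note S_eq = S_eq[folded h_def] and F_def = F_def[folded h_def]
  have node: "0 \<le> theta_node n k" "theta_node n k < pi" "0 < sin (theta_node n k)" if "1 \<le> k" "k \<le> n" for k
    using theta_node_bounds[OF that] by (auto intro: sin_gt_zero)
  have node_mono: "theta_node n k \<le> theta_node n (Suc k)" for k
    using theta_node_diff[of n "Suc k" k] h by simp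
  \<comment> \<open>Starting at m + 2 puts the nodes at least 3 h beyond \<open>t\<close>. The node
    m + 1 might equal t + h, where a denominator of \<open>F\<close> vanishes.\<close>
  have right: "\<bar>\<Sum>k=m+2..n. S k * e k\<bar> \<le> (\<Sum>k=m+2..n. b k)"
  proof (cases "m + 2 \<le> n")
    case True
    have x: "x k < cos (t + h)" "x k < cos (t - h)" if "m + 2 \<le> k" "k \<le> n" for k
    proof -
      have "2 * (2 * h) \<le> theta_node n k - theta_node n m"
        unfolding theta_node_diff h(3) using that h by (intro mult_right_mono) auto
      then have "t + 3 * h \<le> theta_node n k" using m(3) by (simp add: h_def abs_le_iff)
      moreover have "theta_node n k < pi" using node that m by simp
      ultimately show "x k < cos (t + h)" "x k < cos (t - h)"
        unfolding x_def using h t by (intro cos_less_cos; linarith)+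
    qed
    have F: "0 \<le> F k" "S k = (-1) ^ k * \<tau> * F k" if "m + 2 \<le> k" "k \<le> n" for k
      using x[OF that] node[of k] that S_eq[of k] by (auto simp: F_def)
    show ?thesis
    proof (rule abs_alternating_sum_decreasing_le[OF True])
      show "\<bar>sgn \<tau>\<bar> \<le> 1" by (simp add: sgn_if)
      fix k assume k: "m + 2 \<le> k"
      { assume "k \<le> n" with k F show "S k = (-1) ^ k * sgn \<tau> * \<bar>S k\<bar>" by (intro S_alt) }
      assume kn: "k < n"
      have "F (Suc k) \<le> F k"
        unfolding F_def x_def
        using node[of k] node[of "Suc k"] node_mono[of k] x[of k] k kn
        by (intro sin_quotient_decreasing) (auto simp: x_def)
      then show "\<bar>S (Suc k)\<bar> \<le> \<bar>S k\<bar>"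
        using S_alt(2)[OF F(2,1)] k kn by (simp add: mult_left_mono)
      show "\<bar>S (Suc k)\<bar> * \<bar>e (Suc k) - e k\<bar> \<le> b (Suc k)"
        using k kn by (intro adj) auto
    qed (use True near in auto)
  qed simp
  have left: "\<bar>\<Sum>k=1..m-2. S k * e k\<bar> \<le> (\<Sum>k=1..m-2. b k)"
  proof (cases "1 \<le> m - 2")
    case True
    have x: "cos (t + h) < x k" "cos (t - h) < x k" if "1 \<le> k" "k \<le> m - 2" for k
    proof -
      have "2 * (2 * h) \<le> theta_node n m - theta_node n k"
        unfolding theta_node_diff h(3) using that h by (intro mult_right_mono) auto
      then have "theta_node n k \<le> t - 3 * h" using m(3) by (simp add: h_def abs_le_iff)
      moreover have "0 \<le> theta_node n k" using node that m by simp
      ultimately show "cos (t + h) < x k" "cos (t - h) < x k"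
        unfolding x_def using h t by (intro cos_less_cos; linarith)+
    qed
    \<comment> \<open>Here both factors of the denominator are negative, so their product is
      positive.\<close>
    have F: "0 \<le> F k" "S k = (-1) ^ k * \<tau> * F k" if "1 \<le> k" "k \<le> m - 2" for k
      using x[OF that] node[of k] that m S_eq[of k]
      by (auto simp: F_def intro!: divide_nonneg_nonneg mult_nonpos_nonpos less_imp_le[of 0 "sin _"])
    show ?thesis
    proof (rule abs_alternating_sum_increasing_le[OF True])
      show "\<bar>sgn \<tau>\<bar> \<le> 1" by (simp add: sgn_if)
      fix k :: nat assume k: "1 \<le> k"
      { assume "k \<le> m - 2" with k F show "S k = (-1) ^ k * sgn \<tau> * \<bar>S k\<bar>" by (intro S_alt) }
      assume km: "k < m - 2"
      have "F k \<le> F (Suc k)"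
        unfolding F_def x_def
        using node(1)[of k] node(2)[of "Suc k"] node_mono[of k] x[of "Suc k"] k km m
        by (intro sin_quotient_increasing) (auto simp: x_def less_imp_le)
      then show "\<bar>S k\<bar> \<le> \<bar>S (Suc k)\<bar>"
        using S_alt(2)[OF F(2,1)] k km by (simp add: mult_left_mono)
      show "\<bar>S k\<bar> * \<bar>e k - e (Suc k)\<bar> \<le> b k"
        using k km m by (intro adj) auto
    qed (use True near m in auto)
  qed simp
  \<comment> \<open>Truncated subtraction makes the left range empty for m \<le> 2; the intersection
    with {1..n} discards the index 0 and those above \<open>n\<close>.\<close>
  have split: "sum f {1..n} = sum f {1..m-2} + sum f ({1..n} \<inter> {m-1..m+1}) + sum f {m+2..n}" for f :: "nat \<Rightarrow> real"
  proof -
    have "{1..n} = ({1..m-2} \<union> ({1..n} \<inter> {m-1..m+1})) \<union> {m+2..n}" using m by auto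
    then have "sum f {1..n} = sum f (({1..m-2} \<union> ({1..n} \<inter> {m-1..m+1})) \<union> {m+2..n})" by (rule arg_cong)
    also have "\<dots> = sum f ({1..m-2} \<union> ({1..n} \<inter> {m-1..m+1})) + sum f {m+2..n}"
      using m by (intro sum.union_disjoint) auto
    also have "sum f ({1..m-2} \<union> ({1..n} \<inter> {m-1..m+1})) = sum f {1..m-2} + sum f ({1..n} \<inter> {m-1..m+1})"
      using m by (intro sum.union_disjoint) auto
    finally show ?thesis .
  qed
  have middle: "\<bar>\<Sum>k\<in>{1..n} \<inter> {m-1..m+1}. S k * e k\<bar> \<le> (\<Sum>k\<in>{1..n} \<inter> {m-1..m+1}. b k)"
    using mid by (intro order_trans[OF sum_abs] sum_mono) auto
  have "\<bar>\<Sum>k=1..n. S k * e k\<bar> \<le> (\<Sum>k=1..n. b k)"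
    unfolding split using left middle right by linarith
  also have "\<dots> \<le> (\<Sum>k=1..n. 2100 * \<omega> * (1 / (1 + (real k - real m)\<^sup>2)))"
  proof (intro sum_mono)
    fix k assume k: "k \<in> {1..n}"
    have "(real k - real m)\<^sup>2 \<le> (real n * (t - theta_node n k))\<^sup>2"
      by (rule node_distance_ge[OF n m(3)])
    then show "b k \<le> 2100 * \<omega> * (1 / (1 + (real k - real m)\<^sup>2))"
      unfolding b_def D_def using w0 by (simp add: frac_le add_pos_nonneg)
  qed
  also have "\<dots> = 2100 * \<omega> * (\<Sum>k=1..n. 1 / (1 + (real k - real m)\<^sup>2))"
    by (rule sum_distrib_left[symmetric])
  also have "\<dots> \<le> 2100 * \<omega> * 8"
    using w0 by (intro mult_left_mono sum_inverse_square_shifted_le) auto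
  finally have "\<bar>\<Sum>k=1..n. S k * e k\<bar> \<le> 16800 * \<omega>" by simp
  moreover have "(\<Sum>k=1..n. S k * e k) = (\<Sum>k=1..n. S k * g (x k)) - (\<Sum>k=1..n. S k) * g (cos t)"
    by (simp add: e_def right_diff_distrib sum_subtractf sum_distrib_right)
  ultimately show ?thesis
    unfolding \<omega>_def[symmetric] using sum_S_fun[OF n, of t] by (simp add: S_def x_def)
qed

subsection \<open>The Durrmeyer operator\<close>

lemma integral_abs_S_fun_le:
  assumes k: "1 \<le> k" "k \<le> n"
  shows "integral {0..pi} (\<lambda>t. \<bar>S_fun n k t\<bar>) \<le> 32 * (pi / real n)"
proof -
  let ?a = "theta_node n k"
  \<comment> \<open>The majorant in \<open>abs_S_fun_le\<close> has an arctangent as antiderivative,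
    whose increment is at most \<pi>.\<close>
  let ?G = "\<lambda>t. 32 / real n * arctan (real n * (t - ?a))"
  have n: "real n > 0" using k by simp
  have "(?G has_real_derivative 32 / (1 + (real n * (t - ?a))\<^sup>2)) (at t within {0..pi})" for t
    using n by (auto intro!: derivative_eq_intros simp: add_pos_nonneg divide_simps)
  then have int: "((\<lambda>t. 32 / (1 + (real n * (t - ?a))\<^sup>2)) has_integral (?G pi - ?G 0)) {0..pi}"
    by (intro fundamental_theorem_of_calculus)
      (auto simp flip: has_real_derivative_iff_has_vector_derivative)
  have "integral {0..pi} (\<lambda>t. \<bar>S_fun n k t\<bar>) \<le> ?G pi - ?G 0"
    unfolding integral_unique[OF int, symmetric]
    using abs_S_fun_le[OF k]
    by (intro integral_le integrable_continuous_interval[of 0 pi "\<lambda>t. \<bar>S_fun n k t\<bar>"]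
        has_integral_integrable[OF int] continuous_intros k) auto
  also have "\<dots> = 32 / real n * (arctan (real n * (pi - ?a)) - arctan (real n * (0 - ?a)))"
    by (simp add: right_diff_distrib)
  also have "\<dots> \<le> 32 / real n * pi"
    using arctan_bounded[of "real n * (pi - ?a)"] arctan_bounded[of "real n * (0 - ?a)"] n
    by (intro mult_left_mono) auto
  finally show ?thesis by simp
qed

lemma set_lebesgue_integral_continuous:
  fixes f :: "real \<Rightarrow> real"
  assumes "continuous_on {a..b} f"
  shows "(LINT t:{a..b}|lebesgue. f t) = integral {a..b} f"
  using absolutely_integrable_continuous_real[OF assms]
  by (rule set_lebesgue_integral_eq_integral(2))

text \<open>If the integral vanished, the kernel would vanish off its node, against its integral
  being \<pi> / n. This makes \<open>delta_fun\<close> positive and allows division by it.\<close>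

lemma integral_dist_S_fun_pos:
  assumes k: "1 \<le> k" "k \<le> n"
  shows "0 < integral {0..pi} (\<lambda>t. \<bar>t - theta_node n k\<bar> * \<bar>S_fun n k t\<bar>)"
proof (rule ccontr)
  let ?f = "\<lambda>t. \<bar>t - theta_node n k\<bar> * \<bar>S_fun n k t\<bar>"
  assume "\<not> ?thesis"
  moreover have c: "continuous_on {0..pi} ?f" by (intro continuous_intros k)
  moreover have "0 \<le> integral {0..pi} ?f" by (intro Henstock_Kurzweil_Integration.integral_nonneg integrable_continuous_interval c) auto
  ultimately have "integral {0..pi} ?f = 0" by linarith
  then have z: "?f t = 0" if "t \<in> {0..pi}" for t
    using integral_eq_0_iff[OF c] that by auto
  have "(S_fun n k has_integral 0) {0..pi}"
    by (rule has_integral_spike[where S = "{theta_node n k}" and f = "\<lambda>_. 0"]) (use z in auto)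
  then have "pi / real n = 0"
    using S_fun_has_integral[OF k] by (rule has_integral_unique[symmetric])
  then show False using k by simp
qed

lemma delta_fun_eq:
  "delta_fun n \<theta> = real n / pi * (\<Sum>k=1..n. \<bar>S_fun n k \<theta>\<bar> *
     integral {0..pi} (\<lambda>t. \<bar>t - theta_node n k\<bar> * \<bar>S_fun n k t\<bar>))"
  unfolding delta_fun_def
  by (intro arg_cong2[where f = "(*)"] refl sum.cong set_lebesgue_integral_continuous continuous_intros) auto

lemma delta_fun_pos:
  assumes "1 \<le> n"
  shows "0 < delta_fun n \<theta>"
proof -
  have "\<exists>k\<in>{1..n}. S_fun n k \<theta> \<noteq> 0"
    using sum_S_fun[OF assms, of \<theta>] by (metis sum.neutral zero_neq_one)
  then obtain k where k: "k \<in> {1..n}" "S_fun n k \<theta> \<noteq> 0" by blast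
  have "0 < (\<Sum>k=1..n. \<bar>S_fun n k \<theta>\<bar> *
     integral {0..pi} (\<lambda>t. \<bar>t - theta_node n k\<bar> * \<bar>S_fun n k t\<bar>))"
    using k integral_dist_S_fun_pos
    by (intro sum_pos2[where i = k]) (auto intro!: mult_pos_pos mult_nonneg_nonneg less_imp_le[OF integral_dist_S_fun_pos])
  then show ?thesis using assms unfolding delta_fun_eq by (intro mult_pos_pos) auto
qed

lemma sum_abs_S_fun_le:
  assumes n: "1 \<le> n" and t: "0 \<le> t" "t \<le> pi"
  shows "(\<Sum>k=1..n. \<bar>S_fun n k t\<bar>) \<le> 256"
proof -
  obtain m where m: "1 \<le> m" "m \<le> n" "\<bar>theta_node n m - t\<bar> \<le> pi / (2 * real n)"
    using exists_close_theta_node[OF n t] .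
  have "(\<Sum>k=1..n. \<bar>S_fun n k t\<bar>) \<le> (\<Sum>k=1..n. 32 * (1 / (1 + (real k - real m)\<^sup>2)))"
  proof (intro sum_mono)
    fix k assume k: "k \<in> {1..n}"
    have "\<bar>S_fun n k t\<bar> \<le> 32 / (1 + (real n * (t - theta_node n k))\<^sup>2)"
      using k t by (intro abs_S_fun_le) auto
    also have "\<dots> \<le> 32 / (1 + (real k - real m)\<^sup>2)"
      using node_distance_ge[OF n m(3)] by (intro frac_le) (auto simp: add_pos_nonneg)
    finally show "\<bar>S_fun n k t\<bar> \<le> 32 * (1 / (1 + (real k - real m)\<^sup>2))" by simp
  qed
  also have "\<dots> \<le> 32 * 8"
    unfolding sum_distrib_left[symmetric] by (intro mult_left_mono sum_inverse_square_shifted_le) auto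
  finally show ?thesis by simp
qed

text \<open>Since each kernel has integral \<pi> / n, the value f(\<theta>_k) can be moved under the
  integral. The scaled modulus bound then leaves the L1 norm of the kernel and the weighted distance
  \<open>J k\<close>.\<close>

lemma durrmeyer_minus_grunwald:
  assumes f: "continuous_on {0..pi} f" and n: "1 \<le> n" and \<theta>: "0 \<le> \<theta>" "\<theta> \<le> pi"
  shows "\<bar>grunwald_durrmeyer n f \<theta> - (\<Sum>k=1..n. S_fun n k \<theta> * f (theta_node n k))\<bar> \<le>
    8193 * modulus_of_continuity {0..pi} f (delta_fun n \<theta>)"
proof -
  define \<delta> where "\<delta> = delta_fun n \<theta>"
  define \<omega> where "\<omega> = modulus_of_continuity {0..pi} f \<delta>"
  have \<delta>: "0 < \<delta>" unfolding \<delta>_def by (rule delta_fun_pos[OF n])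
  have w0: "0 \<le> \<omega>" unfolding \<omega>_def using f \<delta> by (intro modulus_nonneg) auto
  define J where "J k = integral {0..pi} (\<lambda>t. \<bar>t - theta_node n k\<bar> * \<bar>S_fun n k t\<bar>)" for k
  have piece: "\<bar>(LINT t:{0..pi}|lebesgue. f t * S_fun n k t) - pi / real n * f (theta_node n k)\<bar>
      \<le> \<omega> * (32 * (pi / real n) + J k / \<delta>)" if k: "1 \<le> k" "k \<le> n" for k
  proof -
    let ?a = "theta_node n k"
    note c = continuous_on_S_fun[OF k] f continuous_on_subset[OF f]
    have a: "?a \<in> {0..pi}" using theta_node_bounds[OF k] by auto
    have "(LINT t:{0..pi}|lebesgue. f t * S_fun n k t) = integral {0..pi} (\<lambda>t. f t * S_fun n k t)"
      by (intro set_lebesgue_integral_continuous continuous_intros c)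
    moreover have "pi / real n * f ?a = integral {0..pi} (\<lambda>t. f ?a * S_fun n k t)"
      using S_fun_has_integral[OF k] by (simp add: integral_unique mult.commute)
    ultimately have "(LINT t:{0..pi}|lebesgue. f t * S_fun n k t) - pi / real n * f ?a
        = integral {0..pi} (\<lambda>t. f t * S_fun n k t) - integral {0..pi} (\<lambda>t. f ?a * S_fun n k t)"
      by simp
    also have "\<dots> = integral {0..pi} (\<lambda>t. (f t - f ?a) * S_fun n k t)"
      unfolding left_diff_distrib
      by (intro Henstock_Kurzweil_Integration.integral_diff[symmetric] integrable_continuous_interval continuous_intros c)
    finally have eq: "(LINT t:{0..pi}|lebesgue. f t * S_fun n k t) - pi / real n * f ?a
        = integral {0..pi} (\<lambda>t. (f t - f ?a) * S_fun n k t)" .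
    have "\<bar>integral {0..pi} (\<lambda>t. (f t - f ?a) * S_fun n k t)\<bar>
        \<le> integral {0..pi} (\<lambda>t. \<omega> * (\<bar>S_fun n k t\<bar> + (\<bar>t - ?a\<bar> * \<bar>S_fun n k t\<bar>) / \<delta>))"
      unfolding real_norm_def[symmetric]
    proof (rule integral_norm_bound_integral)
      fix t assume t: "t \<in> {0..pi}"
      have "\<bar>f t - f ?a\<bar> * \<bar>S_fun n k t\<bar> \<le> (1 + \<bar>t - ?a\<bar> / \<delta>) * \<omega> * \<bar>S_fun n k t\<bar>"
        unfolding \<omega>_def by (intro mult_right_mono abs_diff_le_modulus_scaled[OF f t a \<delta>]) auto
      then show "norm ((f t - f ?a) * S_fun n k t) \<le> \<omega> * (norm (S_fun n k t) + (norm (t - ?a) * norm (S_fun n k t)) / \<delta>)"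
        unfolding real_norm_def abs_mult by (simp add: distrib_left distrib_right mult_ac)
    qed (use \<delta> in \<open>auto intro!: integrable_continuous_interval continuous_intros c\<close>)
    also have "\<dots> = \<omega> * (integral {0..pi} (\<lambda>t. \<bar>S_fun n k t\<bar>) + J k / \<delta>)"
    proof -
      have "integral {0..pi} (\<lambda>t. \<bar>S_fun n k t\<bar> + (\<bar>t - ?a\<bar> * \<bar>S_fun n k t\<bar>) / \<delta>)
          = integral {0..pi} (\<lambda>t. \<bar>S_fun n k t\<bar>) + integral {0..pi} (\<lambda>t. (\<bar>t - ?a\<bar> * \<bar>S_fun n k t\<bar>) / \<delta>)"
        using \<delta> by (intro Henstock_Kurzweil_Integration.integral_add integrable_continuous_interval continuous_intros c) auto
      then show ?thesis by (simp add: J_def)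
    qed
    also have "\<dots> \<le> \<omega> * (32 * (pi / real n) + J k / \<delta>)"
      using integral_abs_S_fun_le[OF k] w0 by (intro mult_left_mono add_right_mono)
    finally show ?thesis unfolding eq .
  qed
  have n0: "real n > 0" using n by simp
  have "grunwald_durrmeyer n f \<theta> - (\<Sum>k=1..n. S_fun n k \<theta> * f (theta_node n k))
      = real n / pi * (\<Sum>k=1..n. S_fun n k \<theta> *
          ((LINT t:{0..pi}|lebesgue. f t * S_fun n k t) - pi / real n * f (theta_node n k)))"
    using n0 by (simp add: grunwald_durrmeyer_def right_diff_distrib sum_subtractf sum_distrib_left mult_ac)
  then have "\<bar>grunwald_durrmeyer n f \<theta> - (\<Sum>k=1..n. S_fun n k \<theta> * f (theta_node n k))\<bar>
      = real n / pi * \<bar>\<Sum>k=1..n. S_fun n k \<theta> *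
          ((LINT t:{0..pi}|lebesgue. f t * S_fun n k t) - pi / real n * f (theta_node n k))\<bar>"
    by (simp add: abs_mult)
  also have "\<dots> \<le> real n / pi * (\<Sum>k=1..n. \<bar>S_fun n k \<theta>\<bar> * (\<omega> * (32 * (pi / real n) + J k / \<delta>)))"
    using piece by (intro mult_left_mono order_trans[OF sum_abs] sum_mono) (auto simp: abs_mult intro!: mult_left_mono)
  also have "(\<Sum>k=1..n. \<bar>S_fun n k \<theta>\<bar> * (\<omega> * (32 * (pi / real n) + J k / \<delta>)))
      = \<omega> * (32 * (pi / real n) * (\<Sum>k=1..n. \<bar>S_fun n k \<theta>\<bar>) + (\<Sum>k=1..n. \<bar>S_fun n k \<theta>\<bar> * J k) / \<delta>)"
    by (simp add: sum_distrib_left sum.distrib sum_divide_distrib algebra_simps)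
  also have "real n / pi * \<dots> = \<omega> * (32 * (\<Sum>k=1..n. \<bar>S_fun n k \<theta>\<bar>) +
      (real n / pi * (\<Sum>k=1..n. \<bar>S_fun n k \<theta>\<bar> * J k)) / \<delta>)"
    using n0 by (simp add: field_simps)
  \<comment> \<open>The weighted distances add up to \<delta> itself, so the linear part contributes
    one \<omega>, and the constant is 32 * 256 + 1 = 8193.\<close>
  also have "real n / pi * (\<Sum>k=1..n. \<bar>S_fun n k \<theta>\<bar> * J k) = \<delta>"
    by (simp add: \<delta>_def delta_fun_eq J_def)
  also have "\<omega> * (32 * (\<Sum>k=1..n. \<bar>S_fun n k \<theta>\<bar>) + \<delta> / \<delta>) \<le> \<omega> * (32 * 256 + 1)"
    using sum_abs_S_fun_le[OF n \<theta>] w0 \<delta> by (intro mult_left_mono) auto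
  finally show ?thesis by (simp add: \<omega>_def \<delta>_def mult.commute)
qed

theorem theorem3p3:
  shows "\<exists>C::real. C > 0 \<and>
    (\<forall>f :: real \<Rightarrow> real. continuous_on {0..pi} f \<longrightarrow>
      (\<forall>n::nat. n \<ge> 1 \<longrightarrow> (\<forall>\<theta>\<in>{0..pi}. \<forall>x. x = cos \<theta> \<longrightarrow>
        \<bar>grunwald_durrmeyer n f \<theta> - f \<theta>\<bar> \<le>
          C * (modulus_of_continuity {0..pi} f (delta_fun n \<theta>)
             + modulus_of_continuity {-1..1} (f \<circ> arccos) (sqrt (1 - x\<^sup>2) / real n)
             + modulus_of_continuity {-1..1} (f \<circ> arccos) (1 / (real n)\<^sup>2)))))"
proof (intro exI[of _ 16800] conjI allI impI ballI)
  fix f :: "real \<Rightarrow> real" and n :: nat and \<theta> x :: real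
  assume f: "continuous_on {0..pi} f" and n: "1 \<le> n" and "\<theta> \<in> {0..pi}" and x: "x = cos \<theta>"
  then have \<theta>: "0 \<le> \<theta>" "\<theta> \<le> pi" by auto
  let ?g = "f \<circ> arccos"
  let ?w = "modulus_of_continuity {-1..1} ?g"
  have g: "continuous_on {-1..1} ?g"
    by (intro continuous_on_compose continuous_on_arccos' continuous_on_subset[OF f])
      (auto intro: arccos_lbound arccos_ubound)
  have s: "0 \<le> sin \<theta>" using \<theta> by (intro sin_ge_zero) auto
  have root: "sqrt (1 - x\<^sup>2) = sin \<theta>"
    using s by (simp add: x flip: sin_squared_eq)
  have arc: "?g (cos \<theta>) = f \<theta>" using \<theta> by (simp add: arccos_cos)
  have "(\<Sum>k=1..n. S_fun n k \<theta> * ?g (cos (theta_node n k))) = (\<Sum>k=1..n. S_fun n k \<theta> * f (theta_node n k))"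
    using theta_node_bounds by (intro sum.cong) (auto simp: arccos_cos less_imp_le)
  then have "\<bar>(\<Sum>k=1..n. S_fun n k \<theta> * f (theta_node n k)) - f \<theta>\<bar> \<le> 16800 * ?w (sin \<theta> / real n + 1 / (real n)\<^sup>2)"
    using grunwald_approximation[OF g n \<theta> refl] arc by simp
  also have "\<dots> \<le> 16800 * (?w (sin \<theta> / real n) + ?w (1 / (real n)\<^sup>2))"
    using s by (intro mult_left_mono modulus_add_le[OF g]) auto
  \<comment> \<open>By nonnegativity of the modulus at \<open>delta_fun\<close>, the constant 8193
    of the Durrmeyer part may be enlarged to 16800.\<close>
  finally show "\<bar>grunwald_durrmeyer n f \<theta> - f \<theta>\<bar> \<le>
      16800 * (modulus_of_continuity {0..pi} f (delta_fun n \<theta>)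
             + ?w (sqrt (1 - x\<^sup>2) / real n) + ?w (1 / (real n)\<^sup>2))"
    using durrmeyer_minus_grunwald[OF f n \<theta>]
      modulus_nonneg[OF f _ less_imp_le[OF delta_fun_pos[OF n, of \<theta>]]]
    unfolding root by simp
qed simp

end
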